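(* Let $(M,\lambda_{(i)}(x,y))$ be a GAP-space equipped with a non-linear connection $N^\alpha_\mu$, with canonical $d$-connection $D=(N^\alpha_\mu,\Gamma^\alpha_{\mu\nu},C^\alpha_{\mu\nu})$, whose $h$- and $v$-covariant derivatives are denoted $|$ and $||$. The $h$-, $v$- and $hv$-curvature tensors of the dual $d$-connection $\widetilde D$ can be expressed in the form: (a) $\widetilde R^\alpha_{\mu\sigma\nu}=\Lambda^\alpha_{\sigma\nu|\mu}+C^\alpha_{\epsilon\mu}R^\epsilon_{\sigma\nu}+L^\alpha_{\sigma\nu\mu}+L^\alpha_{\nu\mu\sigma}$; (b) $\widetilde S^\alpha_{\mu\sigma\nu}=T^\alpha_{\sigma\nu||\mu}$; (c) $\widetilde P^\alpha_{\nu\mu\sigma}=T^\alpha_{\mu\nu|\sigma}-\Lambda^\alpha_{\sigma\nu||\mu}+T^\epsilon_{\mu\nu}\Lambda^\alpha_{\sigma\epsilon}-T^\alpha_{\mu\epsilon}\Lambda^\epsilon_{\sigma\nu}-\Lambda^\alpha_{\epsilon\nu}C^\epsilon_{\sigma\mu}-P^\epsilon_{\sigma\mu}T^\alpha_{\epsilon\nu}$. The corresponding curvature tensors of the symmetric $d$-connection $\widehat D$ can be expressed in the form: (d) $\widehat R^\alpha_{\mu\sigma\nu}=\tfrac12(\Lambda^\alpha_{\mu\nu|\sigma}-\Lambda^\alpha_{\mu\sigma|\nu})+\tfrac14(\Lambda^\epsilon_{\mu\nu}\Lambda^\alpha_{\sigma\epsilon}-\Lambda^\epsilon_{\mu\sigma}\Lambda^\alpha_{\nu\epsilon})+\tfrac12\Lambda^\epsilon_{\sigma\nu}\Lambda^\alpha_{\epsilon\mu}+\tfrac12T^\alpha_{\epsilon\mu}R^\epsilon_{\sigma\nu}$;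 (e) $\widehat S^\alpha_{\mu\sigma\nu}=\tfrac12(T^\alpha_{\mu\nu||\sigma}-T^\alpha_{\mu\sigma||\nu})+\tfrac14(T^\epsilon_{\mu\nu}T^\alpha_{\sigma\epsilon}-T^\epsilon_{\mu\sigma}T^\alpha_{\nu\epsilon})+\tfrac12T^\epsilon_{\sigma\nu}T^\alpha_{\epsilon\mu}$; (f) $\widehat P^\alpha_{\nu\mu\sigma}=\tfrac12(\Lambda^\alpha_{\mu\nu|\sigma}-\Lambda^\alpha_{\sigma\nu||\mu})+\tfrac14\Lambda^\epsilon_{\sigma\mu}T^\alpha_{\epsilon\nu}-\tfrac12\Lambda^\alpha_{\epsilon\nu}C^\epsilon_{\sigma\mu}+\tfrac14\mathfrak S_{\mu,\nu,\sigma}\Lambda^\epsilon_{\mu\nu}\Lambda^\alpha_{\sigma\epsilon}-\tfrac12P^\epsilon_{\sigma\mu}T^\alpha_{\epsilon\nu}$. The corresponding curvature tensors of the Riemannian $d$-connection $\mathring D$ can be expressed in the form: (g) $\mathring R^\alpha_{\mu\sigma\nu}=\gamma^\alpha_{\mu\nu|\sigma}-\gamma^\alpha_{\mu\sigma|\nu}+\gamma^\epsilon_{\mu\sigma}\gamma^\alpha_{\epsilon\nu}-\gamma^\epsilon_{\mu\nu}\gamma^\alpha_{\epsilon\sigma}+\gamma^\alpha_{\mu\epsilon}\Lambda^\epsilon_{\nu\sigma}+G^\alpha_{\mu\epsilon}R^\epsilon_{\nu\sigma}$; (h) $\mathring S^\alpha_{\mu\sigma\nu}=G^\alpha_{\mu\nu||\sigma}-G^\alpha_{\mu\sigma||\nu}+G^\epsilon_{\mu\sigma}G^\alpha_{\epsilon\nu}-G^\epsilon_{\mu\nu}G^\alpha_{\epsilon\sigma}+G^\alpha_{\mu\epsilon}T^\epsilon_{\nu\sigma}$;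 (i) $\mathring P^\alpha_{\nu\mu\sigma}=\dot\partial_\mu\gamma^\alpha_{\nu\sigma}-G^\alpha_{\nu\mu|\sigma}+(G^\epsilon_{\nu\mu}-C^\epsilon_{\nu\mu})\gamma^\alpha_{\epsilon\sigma}-(G^\alpha_{\epsilon\mu}-C^\alpha_{\epsilon\mu})\gamma^\epsilon_{\nu\sigma}+P^\epsilon_{\sigma\mu}G^\alpha_{\nu\epsilon}$. Here $L^\alpha_{\nu\mu\sigma}=C^\alpha_{\nu\epsilon}R^\epsilon_{\mu\sigma}$ and $P^\nu_{\sigma\mu}=\dot\partial_\mu N^\nu_\sigma-\Gamma^\nu_{\mu\sigma}$ are formed with the canonical $d$-connection, and $\mathfrak S_{\mu,\nu,\sigma}$ denotes the cyclic sum over $\mu,\nu,\sigma$.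
   Context: $M$ is a $C^\infty$ manifold of dimension $n$, $\pi:TM\to M$ its tangent bundle with induced local coordinates $(x^\mu,y^\mu)$; $\partial_\mu=\partial/\partial x^\mu$, $\dot\partial_\mu=\partial/\partial y^\mu$. All objects are functions of $(x,y)$. Summation convention on repeated Greek and repeated Latin indices. A non-linear connection is a system of functions $N^\alpha_\beta(x,y)$ on induced charts of $TM$ transforming by $N^{\alpha'}_{\beta'}=p^{\alpha'}_{\alpha}p^{\beta}_{\beta'}N^\alpha_\beta+p^{\alpha'}_{\epsilon}p^{\epsilon}_{\beta'\sigma'}y^{\sigma'}$, where $p^{\alpha'}_{\alpha}=\partial x^{\alpha'}/\partial x^{\alpha}$, $p^{\epsilon}_{\beta'\sigma'}=\partial^2x^\epsilon/\partial x^{\beta'}\partial x^{\sigma'}$; set $\delta_\mu=\partial_\mu-N^\alpha_\mu\dot\partial_\alpha$ and $R^\alpha_{\sigma\mu}:=\delta_\mu N^\alpha_\sigma-\delta_\sigma N^\alpha_\mu$ (curvature of $N$). A GAP-space is a manifold $M$ together with $n$ global linearly independent sections $\lambda_{(i)}=(\lambda_{(i)}^\alpha(x,y))$ of the pullback bundle $\pi^{-1}(TM)$; $(\lambda_{(i)\alpha})$ is the inverse matrix ($\lambda_{(i)}^\alpha\lambda_{(i)\beta}=\delta^\alpha_\beta$, $\lambda_{(i)}^\alpha\lambda_{(j)\alpha}=\delta_{ij}$), and $g_{\mu\nu}=\lambda_{(i)\mu}\lambda_{(i)\nu}$ its metric, with inverse $g^{\mu\nu}$. $d$-connections (all with the same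 $N$): - canonical $D=(N,\Gamma,C)$: $\Gamma^\alpha_{\mu\nu}=\lambda_{(i)}^\alpha\delta_\nu\lambda_{(i)\mu}$, $C^\alpha_{\mu\nu}=\lambda_{(i)}^\alpha\dot\partial_\nu\lambda_{(i)\mu}$; - Riemannian $\mathring D=(N,\mathring\Gamma,\mathring C)$: $\mathring\Gamma^\alpha_{\mu\nu}=\tfrac12g^{\alpha\epsilon}(\delta_\mu g_{\nu\epsilon}+\delta_\nu g_{\mu\epsilon}-\delta_\epsilon g_{\mu\nu})$, $\mathring C^\alpha_{\mu\nu}=\tfrac12g^{\alpha\epsilon}(\dot\partial_\mu g_{\nu\epsilon}+\dot\partial_\nu g_{\mu\epsilon}-\dot\partial_\epsilon g_{\mu\nu})$; - dual $\widetilde D=(N,\widetilde\Gamma,\widetilde C)$: $\widetilde\Gamma^\alpha_{\mu\nu}=\Gamma^\alpha_{\nu\mu}$, $\widetilde C^\alpha_{\mu\nu}=C^\alpha_{\nu\mu}$; - symmetric $\widehat D=(N,\widehat\Gamma,\widehat C)$: $\widehat\Gamma^\alpha_{\mu\nu}=\tfrac12(\Gamma^\alpha_{\mu\nu}+\Gamma^\alpha_{\nu\mu})$, $\widehat C^\alpha_{\mu\nu}=\tfrac12(C^\alpha_{\mu\nu}+C^\alpha_{\nu\mu})$. For a $d$-connection $(N,\Gamma,C)$ the $h$- and $v$-covariant derivatives are $A^\alpha_{\mu|\nu}=\delta_\nu A^\alpha_\mu+A^\epsilon_\mu\Gamma^\alpha_{\epsilon\nu}-A^\alpha_\epsilon\Gamma^\epsilon_{\mu\nu}$,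 $A^\alpha_{\mu||\nu}=\dot\partial_\nu A^\alpha_\mu+A^\epsilon_\mu C^\alpha_{\epsilon\nu}-A^\alpha_\epsilon C^\epsilon_{\mu\nu}$ (similarly for other tensor types), and its $h$-, $v$- and $hv$-curvature tensors are $$R^\alpha_{\nu\mu\sigma}=\delta_\sigma\Gamma^\alpha_{\nu\mu}-\delta_\mu\Gamma^\alpha_{\nu\sigma}+\Gamma^\epsilon_{\nu\mu}\Gamma^\alpha_{\epsilon\sigma}-\Gamma^\epsilon_{\nu\sigma}\Gamma^\alpha_{\epsilon\mu}+C^\alpha_{\nu\epsilon}R^\epsilon_{\mu\sigma},$$ $$S^\alpha_{\nu\mu\sigma}=\dot\partial_\sigma C^\alpha_{\nu\mu}-\dot\partial_\mu C^\alpha_{\nu\sigma}+C^\epsilon_{\nu\mu}C^\alpha_{\epsilon\sigma}-C^\epsilon_{\nu\sigma}C^\alpha_{\epsilon\mu},$$ $$P^\alpha_{\nu\mu\sigma}=C^\alpha_{\nu\mu|\sigma}-\dot\partial_\mu\Gamma^\alpha_{\nu\sigma}-(\dot\partial_\mu N^\epsilon_\sigma-\Gamma^\epsilon_{\mu\sigma})C^\alpha_{\nu\epsilon}.$$ The curvature tensors of $\widetilde D,\widehat D,\mathring D$ are obtained by using their own coefficients (and their own $h$-covariant derivative) in these formulas; they carry the corresponding decoration. Tensors of the canonical $d$-connection: torsions $\Lambda^\alpha_{\mu\nu}=\Gamma^\alpha_{\mu\nu}-\Gamma^\alpha_{\nu\mu}$, $T^\alpha_{\mu\nu}=C^\alpha_{\mu\nu}-C^\alpha_{\nu\mu}$;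 contortions $\gamma^\alpha_{\mu\nu}=\Gamma^\alpha_{\mu\nu}-\mathring\Gamma^\alpha_{\mu\nu}$, $G^\alpha_{\mu\nu}=C^\alpha_{\mu\nu}-\mathring C^\alpha_{\mu\nu}$.
   Formalization: Formula (f) is false as printed; it is proved with T^α_{μν|σ} in place of Λ^α_{μν|σ}, and with the cyclic sum replaced by T^ε_{μν}Λ^α_{σε}+Λ^ε_{νσ}T^α_{με}+Λ^ε_{σμ}T^α_{νε}. *)

theory Defs
  imports "HOL-Analysis.Analysis"
begin

section \<open>Smooth manifolds\<close>

text \<open>On an open set \<open>S\<close>: \<open>f\<close> and its iterated directional derivatives of order up to \<open>k\<close> exist
  and are continuous.\<close>

primrec Ck_on :: "nat \<Rightarrow> 'a::euclidean_space set \<Rightarrow> ('a \<Rightarrow> 'b::real_normed_vector) \<Rightarrow> bool" where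
  "Ck_on 0 S f \<longleftrightarrow> continuous_on S f"
| "Ck_on (Suc k) S f \<longleftrightarrow>
     (\<forall>x\<in>S. f differentiable (at x)) \<and> (\<forall>v. Ck_on k S (\<lambda>x. frechet_derivative f (at x) v))"

definition smooth_on :: "'a::euclidean_space set \<Rightarrow> ('a \<Rightarrow> 'b::real_normed_vector) \<Rightarrow> bool" where
  "smooth_on S f \<longleftrightarrow> (\<forall>k. Ck_on k S f)"

text \<open>A chart is a pair of its domain and its coordinate map.\<close>

type_synonym ('a, 'n) chart = "'a set \<times> ('a \<Rightarrow> real^'n)"

definition transition :: "('a, 'n::finite) chart \<Rightarrow> ('a, 'n) chart \<Rightarrow> real^'n \<Rightarrow> real^'n" where
  "transition c c' = snd c' \<circ> inv_into (fst c) (snd c)"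

definition smooth_manifold :: "'a topology \<Rightarrow> ('a, 'n::finite) chart set \<Rightarrow> bool" where
  "smooth_manifold X A \<longleftrightarrow>
     Hausdorff_space X \<and>
     second_countable X \<and>
     (\<Union>c\<in>A. fst c) = topspace X \<and>
     (\<forall>c\<in>A. openin X (fst c) \<and> open (snd c ` fst c) \<and>
        homeomorphic_map (subtopology X (fst c)) (top_of_set (snd c ` fst c)) (snd c)) \<and>
     (\<forall>c\<in>A. \<forall>c'\<in>A. smooth_on (snd c ` (fst c \<inter> fst c')) (transition c c'))"

text \<open>With \<open>x\<close> and \<open>x'\<close> the coordinates of \<open>c\<close> and \<open>c'\<close>, \<open>jac c c' \<alpha>' \<alpha>\<close> is
  \<open>\<partial>x'\<^sup>\<alpha>\<^sup>'/\<partial>x\<^sup>\<alpha>\<close> and \<open>hess c c' \<alpha>' \<beta> \<sigma>\<close> is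
  \<open>\<partial>\<^sup>2x'\<^sup>\<alpha>\<^sup>'/\<partial>x\<^sup>\<beta>\<partial>x\<^sup>\<sigma>\<close>, as functions of \<open>x\<close>.\<close>

definition jac :: "('a, 'n::finite) chart \<Rightarrow> ('a, 'n) chart \<Rightarrow> 'n \<Rightarrow> 'n \<Rightarrow> real^'n \<Rightarrow> real" where
  "jac c c' \<alpha>' \<alpha> x = frechet_derivative (\<lambda>z. transition c c' z $ \<alpha>') (at x) (axis \<alpha> 1)"

definition hess :: "('a, 'n::finite) chart \<Rightarrow> ('a, 'n) chart \<Rightarrow> 'n \<Rightarrow> 'n \<Rightarrow> 'n \<Rightarrow> real^'n \<Rightarrow> real" where
  "hess c c' \<alpha>' \<beta> \<sigma> x = frechet_derivative (jac c c' \<alpha>' \<sigma>) (at x) (axis \<beta> 1)"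


section \<open>Tangent bundle, pullback bundle and non-linear connections\<close>

text \<open>A tangent vector at \<open>m\<close> is the family of its component vectors in the charts around \<open>m\<close>,
  related by the contravariant transformation law; the value at all other arguments is fixed to be
  zero, so that a tangent vector is determined by its components.\<close>

type_synonym ('a, 'n) tvec = "('a, 'n) chart \<Rightarrow> real^'n"

definition tangent_space :: "('a, 'n::finite) chart set \<Rightarrow> 'a \<Rightarrow> ('a, 'n) tvec set" where
  "tangent_space A m = {v.
     (\<forall>c\<in>A. \<forall>c'\<in>A. m \<in> fst c \<and> m \<in> fst c' \<longrightarrow>
        (\<forall>\<alpha>'. v c' $ \<alpha>' = (\<Sum>\<alpha>\<in>UNIV. jac c c' \<alpha>' \<alpha> (snd c m) * v c $ \<alpha>))) \<and>
     (\<forall>c. \<not> (c \<in> A \<and> m \<in> fst c) \<longrightarrow> v c = 0)}"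

definition tangent_bundle :: "'a topology \<Rightarrow> ('a, 'n::finite) chart set \<Rightarrow> ('a \<times> ('a, 'n) tvec) set" where
  "tangent_bundle X A = Sigma (topspace X) (tangent_space A)"

text \<open>Coordinates \<open>(x, y)\<close> on the tangent bundle.\<close>

type_synonym 'n pt = "(real^'n) \<times> (real^'n)"

definition induced_chart :: "('a, 'n::finite) chart \<Rightarrow> 'a \<times> ('a, 'n) tvec \<Rightarrow> 'n pt" where
  "induced_chart c q = (snd c (fst q), snd q c)"

definition induced_dom ::
    "'a topology \<Rightarrow> ('a, 'n::finite) chart set \<Rightarrow> ('a, 'n) chart \<Rightarrow> ('a \<times> ('a, 'n) tvec) set" where
  "induced_dom X A c = {q \<in> tangent_bundle X A. fst q \<in> fst c}"

definition induced_image :: "('a, 'n::finite) chart \<Rightarrow> 'n pt set" where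
  "induced_image c = (snd c ` fst c) \<times> UNIV"

text \<open>A section of the pullback of the tangent bundle along its own projection maps a tangent
  vector at \<open>m\<close> to another tangent vector at \<open>m\<close>.\<close>

definition section_component ::
    "'a topology \<Rightarrow> ('a, 'n::finite) chart set \<Rightarrow> ('a, 'n) chart \<Rightarrow>
     ('a \<times> ('a, 'n) tvec \<Rightarrow> ('a, 'n) tvec) \<Rightarrow> 'n \<Rightarrow> 'n pt \<Rightarrow> real" where
  "section_component X A c s \<alpha> p = s (inv_into (induced_dom X A c) (induced_chart c) p) c $ \<alpha>"

definition pullback_section ::
    "'a topology \<Rightarrow> ('a, 'n::finite) chart set \<Rightarrow> ('a \<times> ('a, 'n) tvec \<Rightarrow> ('a, 'n) tvec) \<Rightarrow> bool" where
  "pullback_section X A s \<longleftrightarrow>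
     (\<forall>q\<in>tangent_bundle X A. s q \<in> tangent_space A (fst q)) \<and>
     (\<forall>c\<in>A. \<forall>\<alpha>. smooth_on (induced_image c) (section_component X A c s \<alpha>))"

text \<open>The sections are indexed by \<open>'n\<close>, so their number is the dimension.\<close>

definition gap_space ::
    "'a topology \<Rightarrow> ('a, 'n::finite) chart set \<Rightarrow>
     ('n \<Rightarrow> 'a \<times> ('a, 'n) tvec \<Rightarrow> ('a, 'n) tvec) \<Rightarrow> bool" where
  "gap_space X A lam \<longleftrightarrow>
     smooth_manifold X A \<and>
     (\<forall>i. pullback_section X A (lam i)) \<and>
     (\<forall>q\<in>tangent_bundle X A. \<forall>a. (\<forall>c. (\<Sum>i\<in>UNIV. a i *\<^sub>R lam i q c) = 0) \<longrightarrow> (\<forall>i. a i = 0))"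

definition nonlinear_connection ::
    "'a topology \<Rightarrow> ('a, 'n::finite) chart set \<Rightarrow>
     (('a, 'n) chart \<Rightarrow> 'n \<Rightarrow> 'n \<Rightarrow> 'n pt \<Rightarrow> real) \<Rightarrow> bool" where
  "nonlinear_connection X A N \<longleftrightarrow>
     (\<forall>c\<in>A. \<forall>\<alpha> \<beta>. smooth_on (induced_image c) (N c \<alpha> \<beta>)) \<and>
     (\<forall>c\<in>A. \<forall>c'\<in>A. \<forall>q \<in> induced_dom X A c \<inter> induced_dom X A c'. \<forall>\<alpha>' \<beta>'.
        let (x, y) = induced_chart c q; (x', y') = induced_chart c' q in
        N c' \<alpha>' \<beta>' (x', y') =
          (\<Sum>\<alpha>\<in>UNIV. \<Sum>\<beta>\<in>UNIV. jac c c' \<alpha>' \<alpha> x * jac c' c \<beta> \<beta>' x' * N c \<alpha> \<beta> (x, y)) +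
          (\<Sum>\<epsilon>\<in>UNIV. \<Sum>\<sigma>'\<in>UNIV. jac c c' \<alpha>' \<epsilon> x * hess c' c \<epsilon> \<beta>' \<sigma>' x' * y' $ \<sigma>'))"


section \<open>Local geometry in an induced chart\<close>

text \<open>Index order throughout: upper index first, then the lower indices in their written order;
  \<open>N \<alpha> \<beta>\<close> is \<open>N\<^sup>\<alpha>\<^sub>\<beta>\<close>.\<close>

definition dx :: "'n::finite \<Rightarrow> ('n pt \<Rightarrow> real) \<Rightarrow> 'n pt \<Rightarrow> real" where
  "dx \<mu> f p = frechet_derivative f (at p) (axis \<mu> 1, 0)"

definition dy :: "'n::finite \<Rightarrow> ('n pt \<Rightarrow> real) \<Rightarrow> 'n pt \<Rightarrow> real" where
  "dy \<mu> f p = frechet_derivative f (at p) (0, axis \<mu> 1)"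

definition delta ::
    "('n \<Rightarrow> 'n \<Rightarrow> 'n pt \<Rightarrow> real) \<Rightarrow> 'n::finite \<Rightarrow> ('n pt \<Rightarrow> real) \<Rightarrow> 'n pt \<Rightarrow> real" where
  "delta N \<mu> f p = dx \<mu> f p - (\<Sum>\<alpha>\<in>UNIV. N \<alpha> \<mu> p * dy \<alpha> f p)"

definition nl_curvature ::
    "('n \<Rightarrow> 'n \<Rightarrow> 'n pt \<Rightarrow> real) \<Rightarrow> 'n::finite \<Rightarrow> 'n \<Rightarrow> 'n \<Rightarrow> 'n pt \<Rightarrow> real" where
  "nl_curvature N \<alpha> \<sigma> \<mu> p = delta N \<mu> (N \<alpha> \<sigma>) p - delta N \<sigma> (N \<alpha> \<mu>) p"

record 'n d_connection =
  nl :: "'n \<Rightarrow> 'n \<Rightarrow> 'n pt \<Rightarrow> real"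
  hcoeff :: "'n \<Rightarrow> 'n \<Rightarrow> 'n \<Rightarrow> 'n pt \<Rightarrow> real"
  vcoeff :: "'n \<Rightarrow> 'n \<Rightarrow> 'n \<Rightarrow> 'n pt \<Rightarrow> real"

text \<open>Covariant derivatives of a tensor field of type (1,2): \<open>hcov D A \<alpha> \<mu> \<nu> \<sigma>\<close> is
  \<open>A\<^sup>\<alpha>\<^sub>\<mu>\<^sub>\<nu>\<^sub>|\<^sub>\<sigma>\<close> and \<open>vcov D A \<alpha> \<mu> \<nu> \<sigma>\<close> is
  \<open>A\<^sup>\<alpha>\<^sub>\<mu>\<^sub>\<nu>\<^sub>|\<^sub>|\<^sub>\<sigma>\<close>.\<close>

definition hcov ::
    "'n::finite d_connection \<Rightarrow> ('n \<Rightarrow> 'n \<Rightarrow> 'n \<Rightarrow> 'n pt \<Rightarrow> real) \<Rightarrow>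
     'n \<Rightarrow> 'n \<Rightarrow> 'n \<Rightarrow> 'n \<Rightarrow> 'n pt \<Rightarrow> real" where
  "hcov D A \<alpha> \<mu> \<nu> \<sigma> p = delta (nl D) \<sigma> (A \<alpha> \<mu> \<nu>) p +
     (\<Sum>\<epsilon>\<in>UNIV. A \<epsilon> \<mu> \<nu> p * hcoeff D \<alpha> \<epsilon> \<sigma> p) -
     (\<Sum>\<epsilon>\<in>UNIV. A \<alpha> \<epsilon> \<nu> p * hcoeff D \<epsilon> \<mu> \<sigma> p) -
     (\<Sum>\<epsilon>\<in>UNIV. A \<alpha> \<mu> \<epsilon> p * hcoeff D \<epsilon> \<nu> \<sigma> p)"

definition vcov ::
    "'n::finite d_connection \<Rightarrow> ('n \<Rightarrow> 'n \<Rightarrow> 'n \<Rightarrow> 'n pt \<Rightarrow> real) \<Rightarrow>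
     'n \<Rightarrow> 'n \<Rightarrow> 'n \<Rightarrow> 'n \<Rightarrow> 'n pt \<Rightarrow> real" where
  "vcov D A \<alpha> \<mu> \<nu> \<sigma> p = dy \<sigma> (A \<alpha> \<mu> \<nu>) p +
     (\<Sum>\<epsilon>\<in>UNIV. A \<epsilon> \<mu> \<nu> p * vcoeff D \<alpha> \<epsilon> \<sigma> p) -
     (\<Sum>\<epsilon>\<in>UNIV. A \<alpha> \<epsilon> \<nu> p * vcoeff D \<epsilon> \<mu> \<sigma> p) -
     (\<Sum>\<epsilon>\<in>UNIV. A \<alpha> \<mu> \<epsilon> p * vcoeff D \<epsilon> \<nu> \<sigma> p)"

definition h_curvature ::
    "'n::finite d_connection \<Rightarrow> 'n \<Rightarrow> 'n \<Rightarrow> 'n \<Rightarrow> 'n \<Rightarrow> 'n pt \<Rightarrow> real" where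
  "h_curvature D \<alpha> \<nu> \<mu> \<sigma> p =
     delta (nl D) \<sigma> (hcoeff D \<alpha> \<nu> \<mu>) p - delta (nl D) \<mu> (hcoeff D \<alpha> \<nu> \<sigma>) p +
     (\<Sum>\<epsilon>\<in>UNIV. hcoeff D \<epsilon> \<nu> \<mu> p * hcoeff D \<alpha> \<epsilon> \<sigma> p) -
     (\<Sum>\<epsilon>\<in>UNIV. hcoeff D \<epsilon> \<nu> \<sigma> p * hcoeff D \<alpha> \<epsilon> \<mu> p) +
     (\<Sum>\<epsilon>\<in>UNIV. vcoeff D \<alpha> \<nu> \<epsilon> p * nl_curvature (nl D) \<epsilon> \<mu> \<sigma> p)"

definition v_curvature ::
    "'n::finite d_connection \<Rightarrow> 'n \<Rightarrow> 'n \<Rightarrow> 'n \<Rightarrow> 'n \<Rightarrow> 'n pt \<Rightarrow> real" where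
  "v_curvature D \<alpha> \<nu> \<mu> \<sigma> p =
     dy \<sigma> (vcoeff D \<alpha> \<nu> \<mu>) p - dy \<mu> (vcoeff D \<alpha> \<nu> \<sigma>) p +
     (\<Sum>\<epsilon>\<in>UNIV. vcoeff D \<epsilon> \<nu> \<mu> p * vcoeff D \<alpha> \<epsilon> \<sigma> p) -
     (\<Sum>\<epsilon>\<in>UNIV. vcoeff D \<epsilon> \<nu> \<sigma> p * vcoeff D \<alpha> \<epsilon> \<mu> p)"

text \<open>The (v)hv-torsion \<open>P\<^sup>\<nu>\<^sub>\<sigma>\<^sub>\<mu>\<close>; note the exchanged lower indices.\<close>

definition hv_torsion :: "'n::finite d_connection \<Rightarrow> 'n \<Rightarrow> 'n \<Rightarrow> 'n \<Rightarrow> 'n pt \<Rightarrow> real" where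
  "hv_torsion D \<nu> \<sigma> \<mu> p = dy \<mu> (nl D \<nu> \<sigma>) p - hcoeff D \<nu> \<mu> \<sigma> p"

definition hv_curvature ::
    "'n::finite d_connection \<Rightarrow> 'n \<Rightarrow> 'n \<Rightarrow> 'n \<Rightarrow> 'n \<Rightarrow> 'n pt \<Rightarrow> real" where
  "hv_curvature D \<alpha> \<nu> \<mu> \<sigma> p =
     hcov D (vcoeff D) \<alpha> \<nu> \<mu> \<sigma> p - dy \<mu> (hcoeff D \<alpha> \<nu> \<sigma>) p -
     (\<Sum>\<epsilon>\<in>UNIV. (dy \<mu> (nl D \<epsilon> \<sigma>) p - hcoeff D \<epsilon> \<mu> \<sigma> p) * vcoeff D \<alpha> \<nu> \<epsilon> p)"

definition h_torsion :: "'n::finite d_connection \<Rightarrow> 'n \<Rightarrow> 'n \<Rightarrow> 'n \<Rightarrow> 'n pt \<Rightarrow> real" where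
  "h_torsion D \<alpha> \<mu> \<nu> p = hcoeff D \<alpha> \<mu> \<nu> p - hcoeff D \<alpha> \<nu> \<mu> p"

definition v_torsion :: "'n::finite d_connection \<Rightarrow> 'n \<Rightarrow> 'n \<Rightarrow> 'n \<Rightarrow> 'n pt \<Rightarrow> real" where
  "v_torsion D \<alpha> \<mu> \<nu> p = vcoeff D \<alpha> \<mu> \<nu> p - vcoeff D \<alpha> \<nu> \<mu> p"

definition L_tensor :: "'n::finite d_connection \<Rightarrow> 'n \<Rightarrow> 'n \<Rightarrow> 'n \<Rightarrow> 'n \<Rightarrow> 'n pt \<Rightarrow> real" where
  "L_tensor D \<alpha> \<nu> \<mu> \<sigma> p = (\<Sum>\<epsilon>\<in>UNIV. vcoeff D \<alpha> \<nu> \<epsilon> p * nl_curvature (nl D) \<epsilon> \<mu> \<sigma> p)"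


section \<open>The d-connections of a GAP-space\<close>

text \<open>Below, \<open>l i \<alpha>\<close> is the \<open>\<alpha>\<close>-th contravariant component of the \<open>i\<close>-th section,
  \<open>covar l i \<beta>\<close> the corresponding entry of the inverse matrix.\<close>

definition covar :: "('n::finite \<Rightarrow> 'n \<Rightarrow> 'n pt \<Rightarrow> real) \<Rightarrow> 'n \<Rightarrow> 'n \<Rightarrow> 'n pt \<Rightarrow> real" where
  "covar l i \<beta> p = matrix_inv (\<chi> \<alpha> j. l j \<alpha> p) $ i $ \<beta>"

definition metric :: "('n::finite \<Rightarrow> 'n \<Rightarrow> 'n pt \<Rightarrow> real) \<Rightarrow> 'n \<Rightarrow> 'n \<Rightarrow> 'n pt \<Rightarrow> real" where
  "metric l \<mu> \<nu> p = (\<Sum>i\<in>UNIV. covar l i \<mu> p * covar l i \<nu> p)"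

definition inv_metric :: "('n::finite \<Rightarrow> 'n \<Rightarrow> 'n pt \<Rightarrow> real) \<Rightarrow> 'n \<Rightarrow> 'n \<Rightarrow> 'n pt \<Rightarrow> real" where
  "inv_metric l \<mu> \<nu> p = matrix_inv (\<chi> \<alpha> \<beta>. metric l \<alpha> \<beta> p) $ \<mu> $ \<nu>"

definition canonical ::
    "('n \<Rightarrow> 'n \<Rightarrow> 'n pt \<Rightarrow> real) \<Rightarrow> ('n \<Rightarrow> 'n \<Rightarrow> 'n pt \<Rightarrow> real) \<Rightarrow> 'n::finite d_connection" where
  "canonical N l = \<lparr> nl = N,
     hcoeff = (\<lambda>\<alpha> \<mu> \<nu> p. \<Sum>i\<in>UNIV. l i \<alpha> p * delta N \<nu> (covar l i \<mu>) p),
     vcoeff = (\<lambda>\<alpha> \<mu> \<nu> p. \<Sum>i\<in>UNIV. l i \<alpha> p * dy \<nu> (covar l i \<mu>) p) \<rparr>"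

definition riemannian ::
    "('n \<Rightarrow> 'n \<Rightarrow> 'n pt \<Rightarrow> real) \<Rightarrow> ('n \<Rightarrow> 'n \<Rightarrow> 'n pt \<Rightarrow> real) \<Rightarrow> 'n::finite d_connection" where
  "riemannian N l = \<lparr> nl = N,
     hcoeff = (\<lambda>\<alpha> \<mu> \<nu> p. 1/2 * (\<Sum>\<epsilon>\<in>UNIV. inv_metric l \<alpha> \<epsilon> p *
       (delta N \<mu> (metric l \<nu> \<epsilon>) p + delta N \<nu> (metric l \<mu> \<epsilon>) p - delta N \<epsilon> (metric l \<mu> \<nu>) p))),
     vcoeff = (\<lambda>\<alpha> \<mu> \<nu> p. 1/2 * (\<Sum>\<epsilon>\<in>UNIV. inv_metric l \<alpha> \<epsilon> p *
       (dy \<mu> (metric l \<nu> \<epsilon>) p + dy \<nu> (metric l \<mu> \<epsilon>) p - dy \<epsilon> (metric l \<mu> \<nu>) p))) \<rparr>"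

definition dual :: "'n::finite d_connection \<Rightarrow> 'n d_connection" where
  "dual D = \<lparr> nl = nl D,
     hcoeff = (\<lambda>\<alpha> \<mu> \<nu>. hcoeff D \<alpha> \<nu> \<mu>),
     vcoeff = (\<lambda>\<alpha> \<mu> \<nu>. vcoeff D \<alpha> \<nu> \<mu>) \<rparr>"

definition symmetric :: "'n::finite d_connection \<Rightarrow> 'n d_connection" where
  "symmetric D = \<lparr> nl = nl D,
     hcoeff = (\<lambda>\<alpha> \<mu> \<nu> p. 1/2 * (hcoeff D \<alpha> \<mu> \<nu> p + hcoeff D \<alpha> \<nu> \<mu> p)),
     vcoeff = (\<lambda>\<alpha> \<mu> \<nu> p. 1/2 * (vcoeff D \<alpha> \<mu> \<nu> p + vcoeff D \<alpha> \<nu> \<mu> p)) \<rparr>"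

definition h_contortion ::
    "'n::finite d_connection \<Rightarrow> 'n d_connection \<Rightarrow> 'n \<Rightarrow> 'n \<Rightarrow> 'n \<Rightarrow> 'n pt \<Rightarrow> real" where
  "h_contortion D Dr \<alpha> \<mu> \<nu> p = hcoeff D \<alpha> \<mu> \<nu> p - hcoeff Dr \<alpha> \<mu> \<nu> p"

definition v_contortion ::
    "'n::finite d_connection \<Rightarrow> 'n d_connection \<Rightarrow> 'n \<Rightarrow> 'n \<Rightarrow> 'n \<Rightarrow> 'n pt \<Rightarrow> real" where
  "v_contortion D Dr \<alpha> \<mu> \<nu> p = vcoeff D \<alpha> \<mu> \<nu> p - vcoeff Dr \<alpha> \<mu> \<nu> p"

text \<open>In the formula for the hv-curvature of the symmetric d-connection, the literal reading
  \<open>1/2 \<Lambda>\<^sup>\<alpha>\<^sub>\<mu>\<^sub>\<nu>\<^sub>|\<^sub>\<sigma>\<close> with the cyclic sum of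
  \<open>1/4 \<Lambda>\<^sup>\<epsilon>\<^sub>\<mu>\<^sub>\<nu> \<Lambda>\<^sup>\<alpha>\<^sub>\<sigma>\<^sub>\<epsilon>\<close> is false: it fails for
  \<open>n = 2\<close>, \<open>N = 0\<close> and the frame \<open>(1, 0)\<close>, \<open>(0, exp ((x\<^sup>1)\<^sup>2))\<close>.
  Since \<open>\<mu>\<close> is the vertical index of the left-hand side, the theorem is stated with
  \<open>T\<^sup>\<alpha>\<^sub>\<mu>\<^sub>\<nu>\<^sub>|\<^sub>\<sigma>\<close> and with the cyclic sum
  \<open>T\<^sup>\<epsilon>\<^sub>\<mu>\<^sub>\<nu> \<Lambda>\<^sup>\<alpha>\<^sub>\<sigma>\<^sub>\<epsilon> + \<Lambda>\<^sup>\<epsilon>\<^sub>\<nu>\<^sub>\<sigma> T\<^sup>\<alpha>\<^sub>\<mu>\<^sub>\<epsilon> + \<Lambda>\<^sup>\<epsilon>\<^sub>\<sigma>\<^sub>\<mu> T\<^sup>\<alpha>\<^sub>\<nu>\<^sub>\<epsilon>\<close>.\<close>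

end

theory Submission
  imports Defs
begin

text \<open>The canonical d-connection parallelizes the frame: \<open>\<delta>\<^sub>\<nu>\<lambda>\<^sub>\<mu> = \<lambda>\<^sub>\<alpha>\<Gamma>\<^sup>\<alpha>\<^sub>\<mu>\<^sub>\<nu>\<close> and
  \<open>\<partial>\<^sub>\<nu>\<lambda>\<^sub>\<mu> = \<lambda>\<^sub>\<alpha>C\<^sup>\<alpha>\<^sub>\<mu>\<^sub>\<nu>\<close> for every covector \<open>\<lambda>\<close> of the coframe, where \<open>\<partial>\<close> is vertical. Comparing the brackets of the
  fields \<open>\<delta>\<^sub>\<mu>\<close> and \<open>\<partial>\<^sub>\<mu>\<close> with the antisymmetrized second derivatives of the coframe shows that its
  h-, v- and hv-curvatures all vanish. These three vanishing conditions are the only differential input: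
  they express the antisymmetric parts of \<open>\<delta>\<Gamma>\<close> and \<open>\<partial>C\<close>, and all of \<open>\<partial>\<Gamma>\<close>, through the remaining data,
  after which each of the nine formulas is an identity between polynomials in the coefficients. The
  formulas for the Riemannian d-connection hold for any d-connection with the same \<open>N\<close>.\<close>

section \<open>Functions of class \<open>C\<^sup>k\<close>\<close>

lemma Ck_on_Suc_has_derivative:
  "Ck_on (Suc k) S f \<Longrightarrow> x \<in> S \<Longrightarrow> (f has_derivative frechet_derivative f (at x)) (at x)"
  by (auto simp only: Ck_on.simps frechet_derivative_works)

lemma frechet_derivative_cong_on_open:
  assumes "open S" and "x \<in> S" and "\<And>y. y \<in> S \<Longrightarrow> f y = g y"
  shows "frechet_derivative f (at x) = frechet_derivative g (at x)"
proof -
  have "(f has_derivative D) (at x) \<longleftrightarrow> (g has_derivative D) (at x)" for D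
    using assms by (metis has_derivative_transform_within_open)
  then show ?thesis
    unfolding frechet_derivative_def by simp
qed

text \<open>On an open set a derivative at a point depends only on values in the set, so agreement
  passes to all iterated derivatives. Explicit formulas valid on \<open>S\<close> can thus replace
  \<open>frechet_derivative\<close>.\<close>

lemma Ck_on_cong:
  assumes "open S" and "\<And>x. x \<in> S \<Longrightarrow> f x = g x" and "Ck_on k S f"
  shows "Ck_on k S g"
  using assms(2,3)
proof (induction k arbitrary: f g)
  case 0
  then show ?case by (auto cong: continuous_on_cong)
next
  case (Suc k)
  have "g differentiable (at x)" if "x \<in> S" for x
    using Suc.prems that assms(1)
    unfolding differentiable_def
    by (meson Ck_on_Suc_has_derivative has_derivative_transform_within_open)
  moreover have "Ck_on k S (\<lambda>x. frechet_derivative g (at x) v)" for v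
    using Suc.IH[of "\<lambda>x. frechet_derivative f (at x) v"] Suc.prems
      frechet_derivative_cong_on_open[OF assms(1), of _ f g] by fastforce
  ultimately show ?case by simp
qed

lemma Ck_on_Suc_lower: "Ck_on (Suc k) S f \<Longrightarrow> Ck_on k S f"
proof (induction k arbitrary: f)
  case 0
  then show ?case
    by (auto simp: continuous_on_eq_continuous_within differentiable_imp_continuous_within
        intro: continuous_at_imp_continuous_at_within)
next
  case (Suc k)
  then show ?case by (metis Ck_on.simps(2))
qed

lemma Ck_on_const: "Ck_on k S (\<lambda>x. c)"
  by (induction k arbitrary: c) auto

text \<open>The closure rules below all supply a derivative in closed form. With this rule the
  induction on the order treats that formula instead of \<open>frechet_derivative\<close>.\<close>

lemma Ck_on_SucI:
  assumes "open S" and "\<And>x. x \<in> S \<Longrightarrow> (f has_derivative f' x) (at x)"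
    and "\<And>v. Ck_on k S (\<lambda>x. f' x v)"
  shows "Ck_on (Suc k) S f"
proof -
  have "frechet_derivative f (at x) = f' x" if "x \<in> S" for x
    using assms(2)[OF that] frechet_derivative_at by metis
  then have "Ck_on k S (\<lambda>x. frechet_derivative f (at x) v)" for v
    by (intro Ck_on_cong[OF assms(1) _ assms(3)]) simp
  then show ?thesis
    using assms(2) by (auto simp: differentiable_def)
qed

lemma Ck_on_add:
  assumes "open S" and "Ck_on k S f" and "Ck_on k S g"
  shows "Ck_on k S (\<lambda>x. f x + g x)"
  using assms(2,3)
proof (induction k arbitrary: f g)
  case 0
  then show ?case by (simp add: continuous_on_add)
next
  case (Suc k)
  show ?case
  proof (rule Ck_on_SucI[OF assms(1)])
    show "((\<lambda>x. f x + g x) has_derivative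
        (\<lambda>v. frechet_derivative f (at x) v + frechet_derivative g (at x) v)) (at x)" if "x \<in> S" for x
      using Suc.prems[THEN Ck_on_Suc_has_derivative, OF that] by (rule has_derivative_add)
  qed (use Suc in simp)
qed

lemma Ck_on_mult:
  fixes f g :: "'a::euclidean_space \<Rightarrow> real"
  assumes "open S" and "Ck_on k S f" and "Ck_on k S g"
  shows "Ck_on k S (\<lambda>x. f x * g x)"
  using assms(2,3)
proof (induction k arbitrary: f g)
  case 0
  then show ?case by (simp add: continuous_on_mult)
next
  case (Suc k)
  show ?case
  proof (rule Ck_on_SucI[OF assms(1)])
    show "((\<lambda>x. f x * g x) has_derivative
        (\<lambda>v. f x * frechet_derivative g (at x) v + frechet_derivative f (at x) v * g x)) (at x)"
      if "x \<in> S" for x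
      using Suc.prems[THEN Ck_on_Suc_has_derivative, OF that] by (rule has_derivative_mult)
  \<comment> \<open>The product rule keeps one factor undifferentiated; that factor is first lowered
    to order \<open>k\<close>.\<close>
  qed (use Suc Suc.prems[THEN Ck_on_Suc_lower] in \<open>simp add: Ck_on_add[OF assms(1)]\<close>)
qed

lemma Ck_on_sum:
  assumes "open S" and "\<And>i. i \<in> I \<Longrightarrow> Ck_on k S (f i)"
  shows "Ck_on k S (\<lambda>x. \<Sum>i\<in>I. f i x)"
  using assms(2)
  by (induction I rule: infinite_finite_induct) (auto simp: Ck_on_const Ck_on_add[OF assms(1)])

lemma Ck_on_prod:
  fixes f :: "'i \<Rightarrow> 'a::euclidean_space \<Rightarrow> real"
  assumes "open S" and "\<And>i. i \<in> I \<Longrightarrow> Ck_on k S (f i)"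
  shows "Ck_on k S (\<lambda>x. \<Prod>i\<in>I. f i x)"
  using assms(2)
  by (induction I rule: infinite_finite_induct) (auto simp: Ck_on_const Ck_on_mult[OF assms(1)])

lemma Ck_on_inverse:
  fixes f :: "'a::euclidean_space \<Rightarrow> real"
  assumes "open S" and "Ck_on k S f" and nz: "\<And>x. x \<in> S \<Longrightarrow> f x \<noteq> 0"
  shows "Ck_on k S (\<lambda>x. inverse (f x))"
  using assms(2)
proof (induction k)
  case 0
  then show ?case by (simp add: nz continuous_on_inverse)
next
  case (Suc k)
  \<comment> \<open>The derivative of the reciprocal contains the reciprocal again, one order lower,
    where the induction hypothesis applies.\<close>
  have inv: "Ck_on k S (\<lambda>x. inverse (f x))"
    using Suc Ck_on_Suc_lower by blast
  show ?case
  proof (rule Ck_on_SucI[OF assms(1)])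
    \<comment> \<open>The sign is a constant factor \<open>-1\<close>, so that the rules for
      products and constants suffice.\<close>
    show "((\<lambda>x. inverse (f x)) has_derivative
        (\<lambda>v. (-1) * (inverse (f x) * frechet_derivative f (at x) v * inverse (f x)))) (at x)"
      if "x \<in> S" for x
      using Deriv.has_derivative_inverse[OF nz[OF that] Ck_on_Suc_has_derivative[OF Suc.prems that]]
      by simp
    show "Ck_on k S (\<lambda>x. (-1) * (inverse (f x) * frechet_derivative f (at x) v * inverse (f x)))" for v
      using Suc.prems by (intro Ck_on_mult assms(1) inv Ck_on_const) simp
  qed
qed

section \<open>Determinants and inverse matrices\<close>

lemma Ck_on_det:
  fixes M :: "'a::euclidean_space \<Rightarrow> real^'n^'n"
  assumes "open S" and "\<And>i j. Ck_on k S (\<lambda>x. M x $ i $ j)"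
  shows "Ck_on k S (\<lambda>x. det (M x))"
  unfolding det_def
  by (intro Ck_on_sum Ck_on_mult Ck_on_prod Ck_on_const assms)

lemma matrix_inv_inverse:
  assumes "invertible M"
  shows "M ** matrix_inv M = mat 1" and "matrix_inv M ** M = mat 1"
  using assms unfolding invertible_def matrix_inv_def
  by (metis (mono_tags, lifting) someI_ex)+

text \<open>Column \<open>j\<close> of the inverse solves the linear system with right-hand side
  \<open>axis j 1\<close>, so Cramer's rule applies. It exhibits the inverse, defined by choice, as
  a rational function of the entries, which can be differentiated.\<close>

lemma matrix_inv_cofactor:
  fixes M :: "real^'n^'n"
  assumes "invertible M"
  shows "matrix_inv M $ i $ j = det (\<chi> r s. if s = i then axis j 1 $ r else M $ r $ s) * inverse (det M)"
proof -
  have "M *v column j (matrix_inv M) = axis j 1"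
    using assms by (metis matrix_inv_inverse(1) matrix_vector_mul_assoc matrix_vector_mul_lid
        matrix_vector_mult_basis)
  then have "column j (matrix_inv M) = (\<chi> k. det (\<chi> r s. if s = k then axis j 1 $ r else M $ r $ s) / det M)"
    using assms by (simp add: cramer invertible_det_nz)
  then show ?thesis
    by (simp add: column_def vec_eq_iff divide_inverse)
qed

lemma Ck_on_matrix_inv:
  fixes M :: "'a::euclidean_space \<Rightarrow> real^'n^'n"
  assumes S: "open S" and M: "\<And>i j. Ck_on k S (\<lambda>x. M x $ i $ j)"
    and inv: "\<And>x. x \<in> S \<Longrightarrow> invertible (M x)"
  shows "Ck_on k S (\<lambda>x. matrix_inv (M x) $ i $ j)"
proof (rule Ck_on_cong[OF S])
  have "Ck_on k S (\<lambda>x. (\<chi> r s. if s = i then axis j 1 $ r else M x $ r $ s) $ r $ s)" for r s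
    by (cases "s = i") (auto simp: Ck_on_const M)
  then show "Ck_on k S (\<lambda>x. det (\<chi> r s. if s = i then axis j 1 $ r else M x $ r $ s) * inverse (det (M x)))"
    using inv by (intro Ck_on_mult Ck_on_inverse Ck_on_det S M) (auto simp: invertible_det_nz)
qed (simp add: matrix_inv_cofactor inv)

section \<open>Second derivatives and Lie brackets\<close>

lemma has_derivative_along_line:
  assumes "f differentiable (at (a + s *\<^sub>R v))"
  shows "((\<lambda>s. f (a + s *\<^sub>R v)) has_derivative
    (\<lambda>h. h *\<^sub>R frechet_derivative f (at (a + s *\<^sub>R v)) v)) (at s)"
proof -
  have f: "(f has_derivative frechet_derivative f (at (a + s *\<^sub>R v))) (at (a + s *\<^sub>R v))"
    using assms frechet_derivative_works by blast
  have "((\<lambda>s. a + s *\<^sub>R v) has_derivative (\<lambda>h. h *\<^sub>R v)) (at s)"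
    by (auto intro!: derivative_eq_intros)
  from has_derivative_compose[OF this f] show ?thesis
    using linear_scale[OF linear_frechet_derivative[OF assms]] by simp
qed

text \<open>The mean value theorem in direction \<open>v\<close> turns the second difference into
  \<open>t\<close> times a difference of two values of the \<open>v\<close>-derivative near
  \<open>p\<close>. Its linear approximation \<open>L\<close> at \<open>p\<close> evaluates both up
  to an error that is small compared with \<open>t\<close>.\<close>

lemma second_difference_quotient_tendsto:
  fixes f :: "'a::real_normed_vector \<Rightarrow> real"
  assumes "open S" and "p \<in> S" and diff: "\<And>x. x \<in> S \<Longrightarrow> f differentiable (at x)"
    and L: "((\<lambda>x. frechet_derivative f (at x) v) has_derivative L) (at p)"
  shows "((\<lambda>t. (f (p + t *\<^sub>R v + t *\<^sub>R w) - f (p + t *\<^sub>R v) - f (p + t *\<^sub>R w) + f p) / t\<^sup>2)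
    \<longlongrightarrow> L w) (at_right 0)"
proof (rule tendstoI)
  fix e :: real
  assume "e > 0"
  let ?\<Phi> = "\<lambda>t. f (p + t *\<^sub>R v + t *\<^sub>R w) - f (p + t *\<^sub>R v) - f (p + t *\<^sub>R w) + f p"
  let ?D = "\<lambda>x. frechet_derivative f (at x) v"
  \<comment> \<open>Up to a factor \<open>t\<close>, \<open>K\<close> bounds the displacements from
    \<open>p\<close> as well as the sum of the two approximation errors, in which
    \<open>norm v\<close> occurs twice. The summand 1 makes it positive.\<close>
  define K where "K = 2 * norm v + norm w + 1"
  have K: "K > 0" unfolding K_def by (smt (verit) norm_ge_zero)
  interpret L: bounded_linear L using L by (rule has_derivative_bounded_linear)
  from L[unfolded has_derivative_at_alt] \<open>e > 0\<close> K
  obtain d where d: "d > 0"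
    "\<And>y. norm (y - p) < d \<Longrightarrow> norm (?D y - ?D p - L (y - p)) \<le> e / (2 * K) * norm (y - p)"
    by (metis divide_pos_pos mult_pos_pos zero_less_numeral)
  obtain r where r: "r > 0" "ball p r \<subseteq> S"
    using assms(1,2) open_contains_ball by blast
  have "dist (?\<Phi> t / t\<^sup>2) (L w) < e" if t: "t > 0" "t < min d r / K" for t
  proof -
    have near: "norm (s *\<^sub>R v + u *\<^sub>R w) \<le> s * norm v + u * norm w"
      "norm (s *\<^sub>R v + u *\<^sub>R w) < min d r" if "0 \<le> s" "s \<le> t" "0 \<le> u" "u \<le> t" for s u
    proof -
      have "norm (s *\<^sub>R v + u *\<^sub>R w) \<le> s * norm v + u * norm w"
        using norm_triangle_ineq[of "s *\<^sub>R v" "u *\<^sub>R w"] that by simp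
      moreover have "s * norm v + u * norm w \<le> t * norm v + t * norm w"
        using that by (intro add_mono mult_right_mono) auto
      moreover have "t * norm v + t * norm w \<le> t * K"
        using t(1) by (simp add: K_def algebra_simps)
      moreover have "t * K < min d r"
        using t(2) K by (simp add: pos_less_divide_eq)
      ultimately show "norm (s *\<^sub>R v + u *\<^sub>R w) \<le> s * norm v + u * norm w"
        "norm (s *\<^sub>R v + u *\<^sub>R w) < min d r" by linarith+
    qed
    have inS: "p + s *\<^sub>R v + u *\<^sub>R w \<in> S" if "0 \<le> s" "s \<le> t" "0 \<le> u" "u \<le> t" for s u
      using near(2)[OF that] r(2) by (auto simp: dist_norm algebra_simps norm_minus_commute
          intro!: subsetD[OF r(2)])
    have line: "((\<lambda>s. f (p + s *\<^sub>R v + u *\<^sub>R w)) has_derivative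
        (\<lambda>h. h *\<^sub>R ?D (p + s *\<^sub>R v + u *\<^sub>R w))) (at s)" if "0 \<le> s" "s \<le> t" "0 \<le> u" "u \<le> t" for s u
      using has_derivative_along_line[of f "p + u *\<^sub>R w" s v] diff[OF inS[OF that]]
      by (simp add: algebra_simps)
    \<comment> \<open>Both terms are instances of \<open>line\<close>, the second with
      \<open>u = 0\<close>. Applying the mean value theorem to their difference gives one
      \<open>x\<close> common to both.\<close>
    let ?g = "\<lambda>s. f (p + s *\<^sub>R v + t *\<^sub>R w) - f (p + s *\<^sub>R v + 0 *\<^sub>R w)"
    have "\<exists>x\<in>{0<..<t}. ?g t - ?g 0 =
        (t - 0) *\<^sub>R ?D (p + x *\<^sub>R v + t *\<^sub>R w) - (t - 0) *\<^sub>R ?D (p + x *\<^sub>R v + 0 *\<^sub>R w)"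
    proof (rule mvt_simple[OF t(1)])
      show "(?g has_derivative (\<lambda>h. h *\<^sub>R ?D (p + s *\<^sub>R v + t *\<^sub>R w) - h *\<^sub>R ?D (p + s *\<^sub>R v + 0 *\<^sub>R w)))
          (at s within {0..t})" if "0 \<le> s" "s \<le> t" for s
        by (rule has_derivative_at_withinI, intro has_derivative_diff line) (use that t(1) in simp_all)
    qed
    then obtain x where x: "0 < x" "x < t"
      and \<Phi>: "?\<Phi> t = t * (?D (p + x *\<^sub>R v + t *\<^sub>R w) - ?D (p + x *\<^sub>R v + 0 *\<^sub>R w))"
      by (auto simp: right_diff_distrib)
    have E: "\<bar>?D (p + x *\<^sub>R v + u *\<^sub>R w) - ?D p - L (x *\<^sub>R v + u *\<^sub>R w)\<bar> \<le> e / (2 * K) * (t * norm v + u * norm w)"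
      if "0 \<le> u" "u \<le> t" for u
    proof -
      have "\<bar>?D (p + (x *\<^sub>R v + u *\<^sub>R w)) - ?D p - L (x *\<^sub>R v + u *\<^sub>R w)\<bar> \<le> e / (2 * K) * norm (x *\<^sub>R v + u *\<^sub>R w)"
        using d(2)[of "p + (x *\<^sub>R v + u *\<^sub>R w)"] near(2)[of x u] x that by simp
      also have "\<dots> \<le> e / (2 * K) * (x * norm v + u * norm w)"
        using near(1)[of x u] x that K \<open>e > 0\<close> by (intro mult_left_mono) auto
      also have "\<dots> \<le> e / (2 * K) * (t * norm v + u * norm w)"
        using x K \<open>e > 0\<close> by (intro mult_left_mono add_right_mono mult_right_mono) auto
      finally show ?thesis by (simp add: add.assoc)
    qed
    \<comment> \<open>The contribution of the unknown intermediate point \<open>x\<close>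
      cancels.\<close>
    have "L (x *\<^sub>R v + t *\<^sub>R w) - L (x *\<^sub>R v + 0 *\<^sub>R w) = t * L w"
      by (simp add: L.add L.scaleR)
    then have "\<bar>?\<Phi> t / t - t * L w\<bar> \<le> e / (2 * K) * (t * norm v + t * norm w) + e / (2 * K) * (t * norm v + 0 * norm w)"
      using E[of t] E[of 0] t(1) unfolding \<Phi> by (simp del: scaleR_zero_left)
    also have "\<dots> = t * (e / (2 * K) * (2 * norm v + norm w))"
      by (simp add: algebra_simps)
    also have "\<dots> \<le> t * (e / (2 * K) * K)"
      using t(1) K \<open>e > 0\<close> by (intro mult_left_mono) (auto simp: K_def)
    also have "\<dots> = t * (e / 2)"
      using K by simp
    finally have "\<bar>?\<Phi> t / t - t * L w\<bar> \<le> t * (e / 2)" .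
    moreover have "?\<Phi> t / t - t * L w = t * (?\<Phi> t / t\<^sup>2 - L w)"
      using t(1) by (simp add: field_simps power2_eq_square)
    ultimately have "\<bar>?\<Phi> t / t\<^sup>2 - L w\<bar> \<le> e / 2"
      using t(1) by (simp add: abs_mult)
    then show ?thesis
      using \<open>e > 0\<close> by (simp add: dist_real_def)
  qed
  then show "\<forall>\<^sub>F t in at_right 0. dist (?\<Phi> t / t\<^sup>2) (L w) < e"
    unfolding eventually_at_right_field
    by (intro exI[of _ "min d r / K"]) (use d(1) r(1) K in auto)
qed

text \<open>The second difference is symmetric in \<open>v\<close> and \<open>w\<close>, and both
  iterated derivatives are limits of the same quotient.\<close>

lemma symmetric_second_derivative:
  fixes f :: "'a::euclidean_space \<Rightarrow> real"
  assumes S: "open S" and p: "p \<in> S" and f: "Ck_on 2 S f"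
  shows "frechet_derivative (\<lambda>x. frechet_derivative f (at x) v) (at p) w =
    frechet_derivative (\<lambda>x. frechet_derivative f (at x) w) (at p) v"
proof -
  have f1: "f differentiable (at x)" if "x \<in> S" for x
    using f that by (simp add: numeral_2_eq_2)
  have "((\<lambda>x. frechet_derivative f (at x) u) has_derivative
      frechet_derivative (\<lambda>x. frechet_derivative f (at x) u) (at p)) (at p)" for u
    using f p by (intro Ck_on_Suc_has_derivative[of 0 S]) (simp_all add: numeral_2_eq_2)
  note lim = second_difference_quotient_tendsto[OF S p f1 this]
  show ?thesis
    using tendsto_unique[OF _ lim[of v w]] lim[of w v] by (simp add: algebra_simps)
qed

text \<open>\<open>Ck_on\<close> controls derivatives in fixed directions, so the moving direction
  \<open>Y q\<close> is expanded in the basis. The product rule then separates second derivatives of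
  \<open>f\<close> from the derivative of \<open>Y\<close>.\<close>

lemma has_derivative_along_field:
  fixes f :: "'a::euclidean_space \<Rightarrow> real"
  assumes S: "open S" and p: "p \<in> S" and f: "Ck_on 2 S f" and Y: "(Y has_derivative Y') (at p)"
  shows "((\<lambda>q. frechet_derivative f (at q) (Y q)) has_derivative
    (\<lambda>h. frechet_derivative (\<lambda>q. frechet_derivative f (at q) (Y p)) (at p) h
      + frechet_derivative f (at p) (Y' h))) (at p)"
proof -
  have expand: "frechet_derivative f (at q) y = (\<Sum>b\<in>Basis. (y \<bullet> b) * frechet_derivative f (at q) b)"
    if "q \<in> S" for q y
  proof -
    interpret linear "frechet_derivative f (at q)"
      using f that by (intro linear_frechet_derivative) (simp add: numeral_2_eq_2)
    have "frechet_derivative f (at q) y = frechet_derivative f (at q) (\<Sum>b\<in>Basis. (y \<bullet> b) *\<^sub>R b)"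
      by (simp add: euclidean_representation)
    then show ?thesis by (simp only: sum scale real_scaleR_def)
  qed
  have second: "((\<lambda>x. frechet_derivative f (at x) u) has_derivative
      frechet_derivative (\<lambda>x. frechet_derivative f (at x) u) (at p)) (at p)" for u
    using f p by (intro Ck_on_Suc_has_derivative[of 0 S]) (simp_all add: numeral_2_eq_2)
  have Yb: "((\<lambda>q. Y q \<bullet> b) has_derivative (\<lambda>h. Y' h \<bullet> b)) (at p)" for b
    using Y by (rule has_derivative_inner_left)
  \<comment> \<open>Freezing the field at \<open>p\<close> identifies the part of the sum that
    contains only second derivatives of \<open>f\<close>.\<close>
  have "((\<lambda>q. \<Sum>b\<in>Basis. (Y p \<bullet> b) * frechet_derivative f (at q) b) has_derivative
      (\<lambda>h. \<Sum>b\<in>Basis. (Y p \<bullet> b) * frechet_derivative (\<lambda>x. frechet_derivative f (at x) b) (at p) h)) (at p)"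
    by (intro has_derivative_sum has_derivative_mult_right second)
  then have "((\<lambda>q. frechet_derivative f (at q) (Y p)) has_derivative
      (\<lambda>h. \<Sum>b\<in>Basis. (Y p \<bullet> b) * frechet_derivative (\<lambda>x. frechet_derivative f (at x) b) (at p) h)) (at p)"
    by (rule has_derivative_transform_within_open[OF _ S p]) (rule expand[symmetric])
  then have Yp: "frechet_derivative (\<lambda>q. frechet_derivative f (at q) (Y p)) (at p) h =
      (\<Sum>b\<in>Basis. (Y p \<bullet> b) * frechet_derivative (\<lambda>x. frechet_derivative f (at x) b) (at p) h)" for h
    by (rule fun_cong[OF frechet_derivative_at[symmetric]])
  have "((\<lambda>q. \<Sum>b\<in>Basis. (Y q \<bullet> b) * frechet_derivative f (at q) b) has_derivative
      (\<lambda>h. \<Sum>b\<in>Basis. (Y p \<bullet> b) * frechet_derivative (\<lambda>x. frechet_derivative f (at x) b) (at p) h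
        + (Y' h \<bullet> b) * frechet_derivative f (at p) b)) (at p)"
    by (intro has_derivative_sum has_derivative_mult second Yb)
  then have "((\<lambda>q. \<Sum>b\<in>Basis. (Y q \<bullet> b) * frechet_derivative f (at q) b) has_derivative
      (\<lambda>h. frechet_derivative (\<lambda>q. frechet_derivative f (at q) (Y p)) (at p) h
        + frechet_derivative f (at p) (Y' h))) (at p)"
    unfolding Yp sum.distrib expand[OF p, of "Y' _", symmetric] .
  then show ?thesis
    by (rule has_derivative_transform_within_open[OF _ S p]) (rule expand[symmetric])
qed

text \<open>The second derivatives of \<open>f\<close> cancel by symmetry. What remains is the
  derivative along \<open>Y' (X p) - X' (Y p)\<close>, the Lie bracket of the two fields at
  \<open>p\<close>.\<close>

lemma lie_bracket_derivative:
  fixes f :: "'a::euclidean_space \<Rightarrow> real"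
  assumes S: "open S" and p: "p \<in> S" and f: "Ck_on 2 S f"
    and X: "(X has_derivative X') (at p)" and Y: "(Y has_derivative Y') (at p)"
  shows "frechet_derivative (\<lambda>q. frechet_derivative f (at q) (Y q)) (at p) (X p)
      - frechet_derivative (\<lambda>q. frechet_derivative f (at q) (X q)) (at p) (Y p)
    = frechet_derivative f (at p) (Y' (X p) - X' (Y p))"
proof -
  have "f differentiable (at p)"
    using f p by (simp add: numeral_2_eq_2)
  then interpret linear "frechet_derivative f (at p)"
    by (rule linear_frechet_derivative)
  show ?thesis
    using symmetric_second_derivative[OF S p f, of "Y p" "X p"]
    by (simp add: frechet_derivative_at[symmetric, OF has_derivative_along_field[OF S p f X]]
        frechet_derivative_at[symmetric, OF has_derivative_along_field[OF S p f Y]] diff)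
qed

text \<open>The conclusion is the bracket formula of \<open>X\<close> and \<open>Y\<close>, applied to the frame and cleared of the
  invertible matrix \<open>\<theta>\<close>.\<close>

lemma parallel_frame_integrability:
  fixes \<theta> l :: "'n::finite \<Rightarrow> 'n \<Rightarrow> 'a::euclidean_space \<Rightarrow> real"
    and A B :: "'n \<Rightarrow> 'n \<Rightarrow> 'a \<Rightarrow> real"
  assumes S: "open S" and p: "p \<in> S" and \<theta>: "\<And>i \<mu>. Ck_on 2 S (\<theta> i \<mu>)"
    and X: "(X has_derivative X') (at p)" and Y: "(Y has_derivative Y') (at p)"
    and A: "\<And>\<alpha> \<mu>. A \<alpha> \<mu> differentiable (at p)" and B: "\<And>\<alpha> \<mu>. B \<alpha> \<mu> differentiable (at p)"
    and \<theta>X: "\<And>i \<mu> q. q \<in> S \<Longrightarrow> frechet_derivative (\<theta> i \<mu>) (at q) (X q) = (\<Sum>\<alpha>\<in>UNIV. \<theta> i \<alpha> q * A \<alpha> \<mu> q)"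
    and \<theta>Y: "\<And>i \<mu> q. q \<in> S \<Longrightarrow> frechet_derivative (\<theta> i \<mu>) (at q) (Y q) = (\<Sum>\<alpha>\<in>UNIV. \<theta> i \<alpha> q * B \<alpha> \<mu> q)"
    and \<theta>E: "\<And>i. frechet_derivative (\<theta> i \<mu>) (at p) (Y' (X p) - X' (Y p)) = (\<Sum>\<alpha>\<in>UNIV. \<theta> i \<alpha> p * E \<alpha>)"
    and inv: "\<And>\<alpha> \<beta>. (\<Sum>i\<in>UNIV. l i \<beta> p * \<theta> i \<alpha> p) = (if \<alpha> = \<beta> then 1 else 0)"
  shows "frechet_derivative (B \<beta> \<mu>) (at p) (X p) - frechet_derivative (A \<beta> \<mu>) (at p) (Y p)
    + (\<Sum>\<epsilon>\<in>UNIV. A \<beta> \<epsilon> p * B \<epsilon> \<mu> p) - (\<Sum>\<epsilon>\<in>UNIV. B \<beta> \<epsilon> p * A \<epsilon> \<mu> p) = E \<beta>"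
proof -
  have \<theta>1: "(\<theta> i \<alpha> has_derivative frechet_derivative (\<theta> i \<alpha>) (at p)) (at p)" for i \<alpha>
    using \<theta>[of i \<alpha>] p unfolding numeral_2_eq_2 by (rule Ck_on_Suc_has_derivative)
  \<comment> \<open>Differentiates the parallel equation once more. It is stated for an arbitrary
    field and coefficient matrix because it is used once for \<open>Y\<close> with \<open>B\<close>
    and once for \<open>X\<close> with \<open>A\<close>.\<close>
  have iterated: "frechet_derivative (\<lambda>q. frechet_derivative (\<theta> i \<mu>) (at q) (Y q)) (at p) x
      = (\<Sum>\<alpha>\<in>UNIV. \<theta> i \<alpha> p * frechet_derivative (B \<alpha> \<mu>) (at p) x
          + frechet_derivative (\<theta> i \<alpha>) (at p) x * B \<alpha> \<mu> p)"
    if B: "\<And>\<alpha> \<mu>. B \<alpha> \<mu> differentiable (at p)"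
      and \<theta>Y: "\<And>i \<mu> q. q \<in> S \<Longrightarrow> frechet_derivative (\<theta> i \<mu>) (at q) (Y q) = (\<Sum>\<alpha>\<in>UNIV. \<theta> i \<alpha> q * B \<alpha> \<mu> q)"
    for Y and B :: "'n \<Rightarrow> 'n \<Rightarrow> 'a \<Rightarrow> real" and i x
  proof -
    have "((\<lambda>q. \<Sum>\<alpha>\<in>UNIV. \<theta> i \<alpha> q * B \<alpha> \<mu> q) has_derivative
        (\<lambda>x. \<Sum>\<alpha>\<in>UNIV. \<theta> i \<alpha> p * frechet_derivative (B \<alpha> \<mu>) (at p) x
          + frechet_derivative (\<theta> i \<alpha>) (at p) x * B \<alpha> \<mu> p)) (at p)"
      using B by (intro has_derivative_sum has_derivative_mult \<theta>1) (simp flip: frechet_derivative_works)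
    from frechet_derivative_at[OF this] show ?thesis
      by (subst frechet_derivative_cong_on_open[OF S p \<theta>Y]) (auto simp: fun_eq_iff)
  qed
  define F where "F \<alpha> = frechet_derivative (B \<alpha> \<mu>) (at p) (X p) - frechet_derivative (A \<alpha> \<mu>) (at p) (Y p)
    + (\<Sum>\<epsilon>\<in>UNIV. A \<alpha> \<epsilon> p * B \<epsilon> \<mu> p) - (\<Sum>\<epsilon>\<in>UNIV. B \<alpha> \<epsilon> p * A \<epsilon> \<mu> p)" for \<alpha>
  have swap: "(\<Sum>\<alpha>\<in>UNIV. (\<Sum>\<epsilon>\<in>UNIV. \<theta> i \<epsilon> p * G \<epsilon> \<alpha> p) * H \<alpha> \<mu> p)
      = (\<Sum>\<alpha>\<in>UNIV. \<theta> i \<alpha> p * (\<Sum>\<epsilon>\<in>UNIV. G \<alpha> \<epsilon> p * H \<epsilon> \<mu> p))"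
    for i and G H :: "'n \<Rightarrow> 'n \<Rightarrow> 'a \<Rightarrow> real"
    unfolding sum_distrib_left sum_distrib_right by (subst sum.swap) (simp add: mult.assoc)
  \<comment> \<open>First derivatives of \<open>\<theta>\<close> are replaced by the parallel
    equations, and \<open>swap\<close> moves the remaining factor \<open>\<theta>\<close> to the
    front of every term.\<close>
  have "(\<Sum>\<alpha>\<in>UNIV. \<theta> i \<alpha> p * F \<alpha>) = (\<Sum>\<alpha>\<in>UNIV. \<theta> i \<alpha> p * E \<alpha>)" for i
    using lie_bracket_derivative[OF S p \<theta> X Y, of i \<mu>]
    apply (simp only: iterated[of B Y, OF B \<theta>Y] iterated[of A X, OF A \<theta>X] \<theta>E \<theta>X[OF p] \<theta>Y[OF p]
      sum.distrib swap F_def)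
    by (simp add: sum.distrib sum_subtractf algebra_simps)
  then have "(\<Sum>i\<in>UNIV. l i \<beta> p * (\<Sum>\<alpha>\<in>UNIV. \<theta> i \<alpha> p * F \<alpha>)) = (\<Sum>i\<in>UNIV. l i \<beta> p * (\<Sum>\<alpha>\<in>UNIV. \<theta> i \<alpha> p * E \<alpha>))"
    by simp
  moreover have "(\<Sum>i\<in>UNIV. l i \<beta> p * (\<Sum>\<alpha>\<in>UNIV. \<theta> i \<alpha> p * H \<alpha>)) = H \<beta>" for H
  proof -
    have "(\<Sum>i\<in>UNIV. l i \<beta> p * (\<Sum>\<alpha>\<in>UNIV. \<theta> i \<alpha> p * H \<alpha>)) = (\<Sum>\<alpha>\<in>UNIV. (\<Sum>i\<in>UNIV. l i \<beta> p * \<theta> i \<alpha> p) * H \<alpha>)"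
      unfolding sum_distrib_left sum_distrib_right by (subst sum.swap) (simp add: mult.assoc)
    also have "\<dots> = (\<Sum>\<alpha>\<in>UNIV. if \<alpha> = \<beta> then H \<alpha> else 0)"
      unfolding inv by (intro sum.cong) auto
    finally show ?thesis by simp
  qed
  ultimately have "F \<beta> = E \<beta>" by simp
  then show ?thesis by (simp add: F_def)
qed

section \<open>Flatness of the canonical d-connection\<close>

text \<open>The horizontal field \<delta>_\<mu> as a map into the coordinate space, so that the
  bracket formula for vector fields applies to it.\<close>

definition hor :: "('n \<Rightarrow> 'n \<Rightarrow> 'n pt \<Rightarrow> real) \<Rightarrow> 'n::finite \<Rightarrow> 'n pt \<Rightarrow> 'n pt" where
  "hor N \<mu> p = (axis \<mu> 1, - (\<chi> \<alpha>. N \<alpha> \<mu> p))"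

lemma frechet_derivative_vertical:
  fixes f :: "'n::finite pt \<Rightarrow> real"
  assumes "f differentiable (at p)"
  shows "frechet_derivative f (at p) (0, v) = (\<Sum>\<alpha>\<in>UNIV. v $ \<alpha> * dy \<alpha> f p)"
proof -
  interpret linear "frechet_derivative f (at p)"
    using assms by (rule linear_frechet_derivative)
  have "(0, v) = (\<Sum>\<alpha>\<in>UNIV. v $ \<alpha> *\<^sub>R (0 :: real^'n, axis \<alpha> 1 :: real^'n))"
    by (rule prod_eqI) (simp_all add: fst_sum snd_sum basis_expansion[of v, unfolded scalar_mult_eq_scaleR])
  then show ?thesis
    by (simp only: sum scale dy_def real_scaleR_def)
qed

text \<open>Linearity of the derivative merges the terms of \<open>delta\<close> into one derivative
  along \<open>hor\<close>; this needs differentiability at the point.\<close>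

lemma delta_eq_frechet_derivative:
  assumes "f differentiable (at p)"
  shows "delta N \<mu> f p = frechet_derivative f (at p) (hor N \<mu> p)"
proof -
  interpret linear "frechet_derivative f (at p)"
    using assms by (rule linear_frechet_derivative)
  have "hor N \<mu> p = (axis \<mu> 1, 0) - (0, \<chi> \<alpha>. N \<alpha> \<mu> p)"
    by (simp add: hor_def)
  then show ?thesis
    by (simp only: diff frechet_derivative_vertical[OF assms] delta_def dx_def vec_lambda_beta)
qed

text \<open>The base component of \<open>hor\<close> is constant, so its derivative is vertical.
  Hence every bracket involving \<open>hor\<close> below is vertical.\<close>

lemma has_derivative_hor:
  assumes "\<And>\<alpha>. N \<alpha> \<mu> differentiable (at p)"
  shows "(hor N \<mu> has_derivative (\<lambda>h. (0, - (\<chi> \<alpha>. frechet_derivative (N \<alpha> \<mu>) (at p) h)))) (at p)"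
proof -
  have "((\<lambda>p. \<chi> \<alpha>. N \<alpha> \<mu> p) has_derivative (\<lambda>h. \<chi> \<alpha>. frechet_derivative (N \<alpha> \<mu>) (at p) h)) (at p)"
    using assms by (subst has_derivative_componentwise_within)
      (auto simp: Basis_vec_def inner_axis frechet_derivative_works)
  then have "((\<lambda>p. (axis \<mu> 1, - (\<chi> \<alpha>. N \<alpha> \<mu> p))) has_derivative
      (\<lambda>h. (0, - (\<chi> \<alpha>. frechet_derivative (N \<alpha> \<mu>) (at p) h)))) (at p)"
    by (intro has_derivative_Pair has_derivative_const has_derivative_minus)
  then show ?thesis by (simp add: hor_def[abs_def])
qed

lemma Ck_on_2_dx: "Ck_on 2 S f \<Longrightarrow> Ck_on 1 S (dx \<mu> f)"
  and Ck_on_2_dy: "Ck_on 2 S f \<Longrightarrow> Ck_on 1 S (dy \<mu> f)"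
  by (simp_all add: dx_def[abs_def] dy_def[abs_def] numeral_2_eq_2)

lemma Ck_on_2_lower: "Ck_on 2 S f \<Longrightarrow> Ck_on 1 S f"
  using Ck_on_Suc_lower[of 1 S f] by (simp only: Suc_1)

lemma Ck_on_1_differentiable: "Ck_on 1 S f \<Longrightarrow> p \<in> S \<Longrightarrow> f differentiable (at p)"
  by simp

text \<open>Collects the differential input of the formulas at a single point; from here on they are
  derived without reference to a frame.\<close>

locale flat_d_connection =
  fixes D :: "'n::finite d_connection" and p :: "'n pt"
  assumes hcoeff_differentiable: "\<And>\<alpha> \<mu> \<nu>. hcoeff D \<alpha> \<mu> \<nu> differentiable (at p)"
    and vcoeff_differentiable: "\<And>\<alpha> \<mu> \<nu>. vcoeff D \<alpha> \<mu> \<nu> differentiable (at p)"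
    and h_flat: "\<And>\<alpha> \<mu> \<nu> \<sigma>. h_curvature D \<alpha> \<mu> \<nu> \<sigma> p = 0"
    and v_flat: "\<And>\<alpha> \<mu> \<nu> \<sigma>. v_curvature D \<alpha> \<mu> \<nu> \<sigma> p = 0"
    and hv_flat: "\<And>\<alpha> \<mu> \<nu> \<sigma>. hv_curvature D \<alpha> \<mu> \<nu> \<sigma> p = 0"

text \<open>The curvature of \<open>N\<close> takes one derivative of \<open>N\<close>. The frame
  needs two, because the coefficients contain first derivatives of the coframe and the curvatures
  differentiate them again.\<close>

locale smooth_frame =
  fixes N :: "'n::finite \<Rightarrow> 'n \<Rightarrow> 'n pt \<Rightarrow> real"
    and l :: "'n \<Rightarrow> 'n \<Rightarrow> 'n pt \<Rightarrow> real"
    and S :: "'n pt set"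
  assumes open_S: "open S"
    and Ck_on_N: "\<And>\<alpha> \<mu>. Ck_on 1 S (N \<alpha> \<mu>)"
    and Ck_on_l: "\<And>i \<alpha>. Ck_on 2 S (l i \<alpha>)"
    and frame_invertible: "\<And>p. p \<in> S \<Longrightarrow> invertible (\<chi> \<alpha> j. l j \<alpha> p)"
begin

section \<open>Regularity of the coframe, the metric and the d-connections\<close>

lemma covar_inverse:
  assumes "p \<in> S"
  shows "(\<Sum>i\<in>UNIV. l i \<beta> p * covar l i \<alpha> p) = (if \<alpha> = \<beta> then 1 else 0)"
    and "(\<Sum>\<alpha>\<in>UNIV. covar l i \<alpha> p * l j \<alpha> p) = (if i = j then 1 else 0)"
  using arg_cong[OF matrix_inv_inverse(1)[OF frame_invertible[OF assms]], of "\<lambda>M. M $ \<beta> $ \<alpha>"]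
    arg_cong[OF matrix_inv_inverse(2)[OF frame_invertible[OF assms]], of "\<lambda>M. M $ i $ j"]
  by (simp_all add: matrix_matrix_mult_def mat_def covar_def eq_commute)

lemma Ck_on_covar: "Ck_on 2 S (covar l i \<mu>)"
  using Ck_on_matrix_inv[OF open_S _ frame_invertible, of 2] Ck_on_l by (simp add: covar_def[abs_def])

lemma Ck_on_delta:
  assumes "Ck_on 2 S f"
  shows "Ck_on 1 S (delta N \<mu> f)"
proof -
  have "Ck_on 1 S (\<lambda>p. dx \<mu> f p + (-1) * (\<Sum>\<alpha>\<in>UNIV. N \<alpha> \<mu> p * dy \<alpha> f p))"
    using assms by (intro Ck_on_add Ck_on_mult Ck_on_sum Ck_on_const open_S Ck_on_N Ck_on_2_dx Ck_on_2_dy)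
  then show ?thesis by (simp add: delta_def[abs_def])
qed

lemma Ck_on_canonical:
  "Ck_on 1 S (hcoeff (canonical N l) \<alpha> \<mu> \<nu>)" "Ck_on 1 S (vcoeff (canonical N l) \<alpha> \<mu> \<nu>)"
proof -
  have l1: "Ck_on 1 S (l i \<alpha>)" for i \<alpha>
    using Ck_on_l by (rule Ck_on_2_lower)
  show "Ck_on 1 S (hcoeff (canonical N l) \<alpha> \<mu> \<nu>)"
    unfolding canonical_def d_connection.simps
    by (intro Ck_on_sum Ck_on_mult open_S l1 Ck_on_delta Ck_on_covar)
  show "Ck_on 1 S (vcoeff (canonical N l) \<alpha> \<mu> \<nu>)"
    unfolding canonical_def d_connection.simps
    by (intro Ck_on_sum Ck_on_mult open_S l1 Ck_on_2_dy Ck_on_covar)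
qed

lemma Ck_on_metric: "Ck_on 2 S (metric l \<mu> \<nu>)"
  unfolding metric_def[abs_def] by (intro Ck_on_sum Ck_on_mult open_S Ck_on_covar)

text \<open>With \<open>?B\<close> the matrix of the coframe, the metric is the product of its
  transpose with \<open>?B\<close>, hence a product of invertible matrices.\<close>

lemma invertible_metric:
  assumes "p \<in> S"
  shows "invertible (\<chi> \<alpha> \<beta>. metric l \<alpha> \<beta> p)"
proof -
  let ?B = "matrix_inv (\<chi> \<alpha> j. l j \<alpha> p)"
  have "invertible ?B"
    using matrix_inv_inverse[OF frame_invertible[OF assms]] unfolding invertible_def by blast
  moreover have "(\<chi> \<alpha> \<beta>. metric l \<alpha> \<beta> p) = transpose ?B ** ?B"
    by (simp add: metric_def covar_def matrix_matrix_mult_def transpose_def vec_eq_iff)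
  ultimately show ?thesis by (simp add: invertible_mult transpose_invertible)
qed

lemma Ck_on_inv_metric: "Ck_on 2 S (inv_metric l \<mu> \<nu>)"
  using Ck_on_matrix_inv[OF open_S _ invertible_metric, of 2] Ck_on_metric by (simp add: inv_metric_def[abs_def])

lemma Ck_on_riemannian:
  "Ck_on 1 S (hcoeff (riemannian N l) \<alpha> \<mu> \<nu>)" "Ck_on 1 S (vcoeff (riemannian N l) \<alpha> \<mu> \<nu>)"
proof -
  have g: "Ck_on 1 S (inv_metric l \<mu> \<nu>)" for \<mu> \<nu>
    using Ck_on_inv_metric by (rule Ck_on_2_lower)
  have dg: "Ck_on 1 S (dy \<epsilon> (metric l \<mu> \<nu>))" for \<epsilon> \<mu> \<nu>
    using Ck_on_metric by (rule Ck_on_2_dy)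
  have "Ck_on 1 S (\<lambda>p. 1/2 * (\<Sum>\<epsilon>\<in>UNIV. inv_metric l \<alpha> \<epsilon> p *
      (delta N \<mu> (metric l \<nu> \<epsilon>) p + delta N \<nu> (metric l \<mu> \<epsilon>) p + (-1) * delta N \<epsilon> (metric l \<mu> \<nu>) p)))"
    by (intro Ck_on_sum Ck_on_mult Ck_on_add Ck_on_const open_S g Ck_on_delta Ck_on_metric)
  then show "Ck_on 1 S (hcoeff (riemannian N l) \<alpha> \<mu> \<nu>)"
    by (simp add: riemannian_def)
  have "Ck_on 1 S (\<lambda>p. 1/2 * (\<Sum>\<epsilon>\<in>UNIV. inv_metric l \<alpha> \<epsilon> p *
      (dy \<mu> (metric l \<nu> \<epsilon>) p + dy \<nu> (metric l \<mu> \<epsilon>) p + (-1) * dy \<epsilon> (metric l \<mu> \<nu>) p)))"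
    by (intro Ck_on_sum Ck_on_mult Ck_on_add Ck_on_const open_S g dg)
  then show "Ck_on 1 S (vcoeff (riemannian N l) \<alpha> \<mu> \<nu>)"
    by (simp add: riemannian_def)
qed

text \<open>Contracting the defining formulas of the coefficients with the coframe undoes their
  contraction with the frame.\<close>

lemma covar_parallel:
  assumes "q \<in> S"
  shows "delta N \<nu> (covar l i \<mu>) q = (\<Sum>\<alpha>\<in>UNIV. covar l i \<alpha> q * hcoeff (canonical N l) \<alpha> \<mu> \<nu> q)"
    and "dy \<nu> (covar l i \<mu>) q = (\<Sum>\<alpha>\<in>UNIV. covar l i \<alpha> q * vcoeff (canonical N l) \<alpha> \<mu> \<nu> q)"
proof -
  have *: "(\<Sum>\<alpha>\<in>UNIV. covar l i \<alpha> q * (\<Sum>j\<in>UNIV. l j \<alpha> q * F j)) = F i" for F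
  proof -
    have "(\<Sum>\<alpha>\<in>UNIV. covar l i \<alpha> q * (\<Sum>j\<in>UNIV. l j \<alpha> q * F j)) =
        (\<Sum>j\<in>UNIV. (\<Sum>\<alpha>\<in>UNIV. covar l i \<alpha> q * l j \<alpha> q) * F j)"
      unfolding sum_distrib_left sum_distrib_right by (subst sum.swap) (simp add: mult.assoc)
    also have "\<dots> = (\<Sum>j\<in>UNIV. if i = j then F j else 0)"
      unfolding covar_inverse(2)[OF assms] by (intro sum.cong) auto
    finally show ?thesis by simp
  qed
  show "delta N \<nu> (covar l i \<mu>) q = (\<Sum>\<alpha>\<in>UNIV. covar l i \<alpha> q * hcoeff (canonical N l) \<alpha> \<mu> \<nu> q)"
    "dy \<nu> (covar l i \<mu>) q = (\<Sum>\<alpha>\<in>UNIV. covar l i \<alpha> q * vcoeff (canonical N l) \<alpha> \<mu> \<nu> q)"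
    by (simp_all add: canonical_def *)
qed

section \<open>The three curvatures at a point\<close>

context
  fixes p assumes p: "p \<in> S"
begin

lemma differentiable_at_p:
  "N \<alpha> \<mu> differentiable (at p)"
  "covar l i \<mu> differentiable (at p)"
  "hcoeff (canonical N l) \<alpha> \<mu> \<nu> differentiable (at p)"
  "vcoeff (canonical N l) \<alpha> \<mu> \<nu> differentiable (at p)"
  by (rule Ck_on_1_differentiable[OF _ p], rule Ck_on_N Ck_on_2_lower[OF Ck_on_covar] Ck_on_canonical)+

lemma covar_hor: "q \<in> S \<Longrightarrow> frechet_derivative (covar l i \<mu>) (at q) (hor N \<nu> q) =
    (\<Sum>\<alpha>\<in>UNIV. covar l i \<alpha> q * hcoeff (canonical N l) \<alpha> \<mu> \<nu> q)"
  using Ck_on_1_differentiable[OF Ck_on_2_lower[OF Ck_on_covar]]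
  by (simp flip: covar_parallel(1) delta_eq_frechet_derivative)

lemma covar_ver: "q \<in> S \<Longrightarrow> frechet_derivative (covar l i \<mu>) (at q) (0, axis \<nu> 1) =
    (\<Sum>\<alpha>\<in>UNIV. covar l i \<alpha> q * vcoeff (canonical N l) \<alpha> \<mu> \<nu> q)"
  by (simp add: dy_def flip: covar_parallel(2))

text \<open>Evaluates derivatives of the coframe along vertical brackets through
  \<open>vcoeff\<close> alone.\<close>

lemma covar_vertical: "frechet_derivative (covar l i \<mu>) (at p) (0, v) =
    (\<Sum>\<alpha>\<in>UNIV. covar l i \<alpha> p * (\<Sum>\<epsilon>\<in>UNIV. vcoeff (canonical N l) \<alpha> \<mu> \<epsilon> p * v $ \<epsilon>))"
  unfolding frechet_derivative_vertical[OF differentiable_at_p(2)] covar_parallel(2)[OF p] sum_distrib_left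
  by (subst sum.swap) (simp add: mult_ac)

text \<open>The bracket of \<open>hor N \<sigma>\<close> and \<open>hor N \<mu>\<close> is vertical
  with components \<open>- nl_curvature N \<epsilon> \<mu> \<sigma> p\<close>. By
  \<open>covar_vertical\<close> it accounts exactly for the term with \<open>vcoeff\<close> in the
  h-curvature.\<close>

lemma h_curvature_canonical: "h_curvature (canonical N l) \<alpha> \<nu> \<mu> \<sigma> p = 0"
proof -
  have "frechet_derivative (hcoeff (canonical N l) \<alpha> \<nu> \<mu>) (at p) (hor N \<sigma> p)
      - frechet_derivative (hcoeff (canonical N l) \<alpha> \<nu> \<sigma>) (at p) (hor N \<mu> p)
      + (\<Sum>\<epsilon>\<in>UNIV. hcoeff (canonical N l) \<alpha> \<epsilon> \<sigma> p * hcoeff (canonical N l) \<epsilon> \<nu> \<mu> p)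
      - (\<Sum>\<epsilon>\<in>UNIV. hcoeff (canonical N l) \<alpha> \<epsilon> \<mu> p * hcoeff (canonical N l) \<epsilon> \<nu> \<sigma> p)
    = (\<Sum>\<epsilon>\<in>UNIV. vcoeff (canonical N l) \<alpha> \<nu> \<epsilon> p * - nl_curvature N \<epsilon> \<mu> \<sigma> p)"
  proof (rule parallel_frame_integrability[OF open_S p, where \<theta> = "covar l" and l = l and X = "hor N \<sigma>" and Y = "hor N \<mu>"
        and A = "\<lambda>\<alpha> \<nu>. hcoeff (canonical N l) \<alpha> \<nu> \<sigma>" and B = "\<lambda>\<alpha> \<nu>. hcoeff (canonical N l) \<alpha> \<nu> \<mu>"
        and E = "\<lambda>\<alpha>. \<Sum>\<epsilon>\<in>UNIV. vcoeff (canonical N l) \<alpha> \<nu> \<epsilon> p * - nl_curvature N \<epsilon> \<mu> \<sigma> p"])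
    show "frechet_derivative (covar l i \<nu>) (at p)
        ((0, - (\<chi> \<alpha>. frechet_derivative (N \<alpha> \<mu>) (at p) (hor N \<sigma> p)))
        - (0, - (\<chi> \<alpha>. frechet_derivative (N \<alpha> \<sigma>) (at p) (hor N \<mu> p)))) =
      (\<Sum>\<alpha>\<in>UNIV. covar l i \<alpha> p * (\<Sum>\<epsilon>\<in>UNIV. vcoeff (canonical N l) \<alpha> \<nu> \<epsilon> p * - nl_curvature N \<epsilon> \<mu> \<sigma> p))" for i
      by (simp add: covar_vertical nl_curvature_def delta_eq_frechet_derivative differentiable_at_p)
  qed (simp_all add: Ck_on_covar has_derivative_hor differentiable_at_p covar_hor covar_inverse(1) p)
  then show ?thesis
    by (simp add: h_curvature_def delta_eq_frechet_derivative differentiable_at_p canonical_def[THEN arg_cong[where f = nl]]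
        sum_negf mult.commute)
qed

text \<open>Vertical coordinate fields are constant and have zero bracket, so the right-hand side
  \<open>E\<close> vanishes.\<close>

lemma v_curvature_canonical: "v_curvature (canonical N l) \<alpha> \<nu> \<mu> \<sigma> p = 0"
proof -
  have "frechet_derivative (vcoeff (canonical N l) \<alpha> \<nu> \<mu>) (at p) (0, axis \<sigma> 1)
      - frechet_derivative (vcoeff (canonical N l) \<alpha> \<nu> \<sigma>) (at p) (0, axis \<mu> 1)
      + (\<Sum>\<epsilon>\<in>UNIV. vcoeff (canonical N l) \<alpha> \<epsilon> \<sigma> p * vcoeff (canonical N l) \<epsilon> \<nu> \<mu> p)
      - (\<Sum>\<epsilon>\<in>UNIV. vcoeff (canonical N l) \<alpha> \<epsilon> \<mu> p * vcoeff (canonical N l) \<epsilon> \<nu> \<sigma> p) = 0"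
  proof (rule parallel_frame_integrability[OF open_S p, where \<theta> = "covar l" and l = l
        and X = "\<lambda>_. (0, axis \<sigma> 1)" and Y = "\<lambda>_. (0, axis \<mu> 1)"
        and A = "\<lambda>\<alpha> \<nu>. vcoeff (canonical N l) \<alpha> \<nu> \<sigma>" and B = "\<lambda>\<alpha> \<nu>. vcoeff (canonical N l) \<alpha> \<nu> \<mu>"
        and E = "\<lambda>_. 0"])
    show "((\<lambda>_. (0, axis \<sigma> 1)) has_derivative (\<lambda>_. 0)) (at p)"
      "((\<lambda>_. (0, axis \<mu> 1)) has_derivative (\<lambda>_. 0)) (at p)"
      by (rule has_derivative_const)+
    show "frechet_derivative (covar l i \<nu>) (at p) (0 - 0) = (\<Sum>\<alpha>\<in>UNIV. covar l i \<alpha> p * 0)" for i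
      using linear_0[OF linear_frechet_derivative[OF differentiable_at_p(2)]] by simp
  qed (simp_all add: Ck_on_covar differentiable_at_p covar_ver covar_inverse(1) p)
  then show ?thesis
    by (simp add: v_curvature_def dy_def mult.commute)
qed

text \<open>The bracket of \<open>hor N \<sigma>\<close> with the vertical coordinate field of index
  \<mu> has the vertical components \<open>dy \<mu> (N \<epsilon> \<sigma>) p\<close>.\<close>

lemma hv_curvature_canonical: "hv_curvature (canonical N l) \<alpha> \<nu> \<mu> \<sigma> p = 0"
proof -
  have "frechet_derivative (vcoeff (canonical N l) \<alpha> \<nu> \<mu>) (at p) (hor N \<sigma> p)
      - frechet_derivative (hcoeff (canonical N l) \<alpha> \<nu> \<sigma>) (at p) (0, axis \<mu> 1)
      + (\<Sum>\<epsilon>\<in>UNIV. hcoeff (canonical N l) \<alpha> \<epsilon> \<sigma> p * vcoeff (canonical N l) \<epsilon> \<nu> \<mu> p)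
      - (\<Sum>\<epsilon>\<in>UNIV. vcoeff (canonical N l) \<alpha> \<epsilon> \<mu> p * hcoeff (canonical N l) \<epsilon> \<nu> \<sigma> p)
    = (\<Sum>\<epsilon>\<in>UNIV. vcoeff (canonical N l) \<alpha> \<nu> \<epsilon> p * dy \<mu> (N \<epsilon> \<sigma>) p)"
  proof (rule parallel_frame_integrability[OF open_S p, where \<theta> = "covar l" and l = l
        and X = "hor N \<sigma>" and Y = "\<lambda>_. (0, axis \<mu> 1)"
        and A = "\<lambda>\<alpha> \<nu>. hcoeff (canonical N l) \<alpha> \<nu> \<sigma>" and B = "\<lambda>\<alpha> \<nu>. vcoeff (canonical N l) \<alpha> \<nu> \<mu>"
        and E = "\<lambda>\<alpha>. \<Sum>\<epsilon>\<in>UNIV. vcoeff (canonical N l) \<alpha> \<nu> \<epsilon> p * dy \<mu> (N \<epsilon> \<sigma>) p"])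
    show "((\<lambda>_. (0, axis \<mu> 1)) has_derivative (\<lambda>_. 0)) (at p)"
      by (rule has_derivative_const)
    show "frechet_derivative (covar l i \<nu>) (at p)
        (0 - (0, - (\<chi> \<alpha>. frechet_derivative (N \<alpha> \<sigma>) (at p) (0, axis \<mu> 1)))) =
      (\<Sum>\<alpha>\<in>UNIV. covar l i \<alpha> p * (\<Sum>\<epsilon>\<in>UNIV. vcoeff (canonical N l) \<alpha> \<nu> \<epsilon> p * dy \<mu> (N \<epsilon> \<sigma>) p))" for i
      by (simp add: covar_vertical zero_prod_def dy_def)
  qed (simp_all add: Ck_on_covar has_derivative_hor differentiable_at_p covar_hor covar_ver covar_inverse(1) p)
  \<comment> \<open>The last correction in \<open>hcov\<close> cancels the \<open>hcoeff\<close>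
    part of the final sum of \<open>hv_curvature_def\<close>.\<close>
  then show ?thesis
    by (simp add: hv_curvature_def hcov_def dy_def delta_eq_frechet_derivative differentiable_at_p
        canonical_def[THEN arg_cong[where f = nl]] algebra_simps sum_subtractf)
qed

lemma flat_d_connection_canonical: "flat_d_connection (canonical N l) p"
  by unfold_locales (rule differentiable_at_p h_curvature_canonical v_curvature_canonical hv_curvature_canonical)+

end

end

section \<open>Curvatures in terms of torsion and contortion\<close>

lemma nl_curvature_antisym: "nl_curvature N \<alpha> \<mu> \<sigma> p = - nl_curvature N \<alpha> \<sigma> \<mu> p"
  by (simp add: nl_curvature_def)

section \<open>Derivatives of differences and half-sums\<close>

context
  fixes f g :: "'n::finite pt \<Rightarrow> real" and p
  assumes f: "f differentiable (at p)" and g: "g differentiable (at p)"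
begin

lemma dy_diff: "dy \<mu> (\<lambda>p. f p - g p) p = dy \<mu> f p - dy \<mu> g p"
  unfolding dy_def
  by (subst frechet_derivative_at[symmetric, OF has_derivative_diff[OF
          f[unfolded frechet_derivative_works] g[unfolded frechet_derivative_works]]]) simp

lemma dy_half_sum: "dy \<mu> (\<lambda>p. 1/2 * (f p + g p)) p = 1/2 * (dy \<mu> f p + dy \<mu> g p)"
  unfolding dy_def
  by (subst frechet_derivative_at[symmetric, OF has_derivative_mult_right[OF has_derivative_add[OF
          f[unfolded frechet_derivative_works] g[unfolded frechet_derivative_works]]]]) simp

lemma dx_diff: "dx \<mu> (\<lambda>p. f p - g p) p = dx \<mu> f p - dx \<mu> g p"
  unfolding dx_def
  by (subst frechet_derivative_at[symmetric, OF has_derivative_diff[OF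
          f[unfolded frechet_derivative_works] g[unfolded frechet_derivative_works]]]) simp

lemma dx_half_sum: "dx \<mu> (\<lambda>p. 1/2 * (f p + g p)) p = 1/2 * (dx \<mu> f p + dx \<mu> g p)"
  unfolding dx_def
  by (subst frechet_derivative_at[symmetric, OF has_derivative_mult_right[OF has_derivative_add[OF
          f[unfolded frechet_derivative_works] g[unfolded frechet_derivative_works]]]]) simp

lemma delta_diff: "delta N \<mu> (\<lambda>p. f p - g p) p = delta N \<mu> f p - delta N \<mu> g p"
  by (simp add: delta_def dx_diff dy_diff right_diff_distrib sum_subtractf)

lemma delta_half_sum: "delta N \<mu> (\<lambda>p. 1/2 * (f p + g p)) p = 1/2 * (delta N \<mu> f p + delta N \<mu> g p)"
  unfolding delta_def dx_half_sum dy_half_sum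
  by (simp add: sum.distrib algebra_simps sum_divide_distrib[symmetric] add_divide_distrib)

end

lemma dual_simps [simp]:
  "nl (dual D) = nl D" "hcoeff (dual D) \<alpha> \<mu> \<nu> = hcoeff D \<alpha> \<nu> \<mu>" "vcoeff (dual D) \<alpha> \<mu> \<nu> = vcoeff D \<alpha> \<nu> \<mu>"
  by (simp_all add: dual_def)

lemma symmetric_simps:
  "nl (symmetric D) = nl D"
  "hcoeff (symmetric D) \<alpha> \<mu> \<nu> = (\<lambda>p. 1/2 * (hcoeff D \<alpha> \<mu> \<nu> p + hcoeff D \<alpha> \<nu> \<mu> p))"
  "vcoeff (symmetric D) \<alpha> \<mu> \<nu> = (\<lambda>p. 1/2 * (vcoeff D \<alpha> \<mu> \<nu> p + vcoeff D \<alpha> \<nu> \<mu> p))"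
  by (simp_all add: symmetric_def)

lemma sum_half_sums_mult:
  fixes a b c d :: "'i \<Rightarrow> real"
  shows "(\<Sum>i\<in>I. (1/2 * (a i + b i)) * (1/2 * (c i + d i))) =
    1/4 * ((\<Sum>i\<in>I. a i * c i) + (\<Sum>i\<in>I. a i * d i) + (\<Sum>i\<in>I. b i * c i) + (\<Sum>i\<in>I. b i * d i))"
  unfolding sum.distrib[symmetric] sum_distrib_left by (simp add: algebra_simps add_divide_distrib)

lemma sum_half_sum_mult:
  fixes a b c :: "'i \<Rightarrow> real"
  shows "(\<Sum>i\<in>I. (1/2 * (a i + b i)) * c i) = 1/2 * ((\<Sum>i\<in>I. a i * c i) + (\<Sum>i\<in>I. b i * c i))"
  unfolding sum.distrib[symmetric] sum_distrib_left by (simp add: algebra_simps add_divide_distrib)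

section \<open>The dual and symmetric d-connections in terms of torsion\<close>

context flat_d_connection
begin

text \<open>Vanishing h-curvature, read as a rule that exchanges the index of differentiation with
  the last lower index at the cost of terms without derivatives of the coefficients.\<close>

lemma delta_hcoeff_swap:
  "delta (nl D) \<sigma> (hcoeff D \<alpha> \<nu> \<mu>) p = delta (nl D) \<mu> (hcoeff D \<alpha> \<nu> \<sigma>) p
    - (\<Sum>\<epsilon>\<in>UNIV. hcoeff D \<epsilon> \<nu> \<mu> p * hcoeff D \<alpha> \<epsilon> \<sigma> p)
    + (\<Sum>\<epsilon>\<in>UNIV. hcoeff D \<epsilon> \<nu> \<sigma> p * hcoeff D \<alpha> \<epsilon> \<mu> p)
    - (\<Sum>\<epsilon>\<in>UNIV. vcoeff D \<alpha> \<nu> \<epsilon> p * nl_curvature (nl D) \<epsilon> \<mu> \<sigma> p)"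
  using h_flat[of \<alpha> \<nu> \<mu> \<sigma>] by (simp add: h_curvature_def)

lemma dy_vcoeff_swap:
  "dy \<sigma> (vcoeff D \<alpha> \<nu> \<mu>) p = dy \<mu> (vcoeff D \<alpha> \<nu> \<sigma>) p
    - (\<Sum>\<epsilon>\<in>UNIV. vcoeff D \<epsilon> \<nu> \<mu> p * vcoeff D \<alpha> \<epsilon> \<sigma> p)
    + (\<Sum>\<epsilon>\<in>UNIV. vcoeff D \<epsilon> \<nu> \<sigma> p * vcoeff D \<alpha> \<epsilon> \<mu> p)"
  using v_flat[of \<alpha> \<nu> \<mu> \<sigma>] by (simp add: v_curvature_def)

text \<open>Vanishing hv-curvature trades a vertical derivative of \<Gamma> for a horizontal
  derivative of \<open>vcoeff\<close>.\<close>

lemma dy_hcoeff: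
  "dy \<mu> (hcoeff D \<alpha> \<nu> \<sigma>) p = delta (nl D) \<sigma> (vcoeff D \<alpha> \<nu> \<mu>) p
    + (\<Sum>\<epsilon>\<in>UNIV. vcoeff D \<epsilon> \<nu> \<mu> p * hcoeff D \<alpha> \<epsilon> \<sigma> p)
    - (\<Sum>\<epsilon>\<in>UNIV. vcoeff D \<alpha> \<epsilon> \<mu> p * hcoeff D \<epsilon> \<nu> \<sigma> p)
    - (\<Sum>\<epsilon>\<in>UNIV. dy \<mu> (nl D \<epsilon> \<sigma>) p * vcoeff D \<alpha> \<nu> \<epsilon> p)"
  using hv_flat[of \<alpha> \<nu> \<mu> \<sigma>]
  by (simp add: hv_curvature_def hcov_def algebra_simps sum_subtractf)

lemma delta_h_torsion:
  "delta N \<kappa> (h_torsion D \<alpha> \<mu> \<nu>) p = delta N \<kappa> (hcoeff D \<alpha> \<mu> \<nu>) p - delta N \<kappa> (hcoeff D \<alpha> \<nu> \<mu>) p"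
  by (simp add: h_torsion_def[abs_def] delta_diff hcoeff_differentiable)

lemma delta_v_torsion:
  "delta N \<kappa> (v_torsion D \<alpha> \<mu> \<nu>) p = delta N \<kappa> (vcoeff D \<alpha> \<mu> \<nu>) p - delta N \<kappa> (vcoeff D \<alpha> \<nu> \<mu>) p"
  by (simp add: v_torsion_def[abs_def] delta_diff vcoeff_differentiable)

lemma dy_h_torsion:
  "dy \<kappa> (h_torsion D \<alpha> \<mu> \<nu>) p = dy \<kappa> (hcoeff D \<alpha> \<mu> \<nu>) p - dy \<kappa> (hcoeff D \<alpha> \<nu> \<mu>) p"
  by (simp add: h_torsion_def[abs_def] dy_diff hcoeff_differentiable)

lemma dy_v_torsion:
  "dy \<kappa> (v_torsion D \<alpha> \<mu> \<nu>) p = dy \<kappa> (vcoeff D \<alpha> \<mu> \<nu>) p - dy \<kappa> (vcoeff D \<alpha> \<nu> \<mu>) p"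
  by (simp add: v_torsion_def[abs_def] dy_diff vcoeff_differentiable)

text \<open>The left side differentiates in the directions \<nu> and \<sigma>, the torsion term in
  direction \<mu>. Two exchanges by \<open>delta_hcoeff_swap\<close> reconcile them, and each leaves
  one of the terms \<open>L_tensor\<close>; the remaining curvature term is the one already present
  for the dual.\<close>

lemma h_curvature_dual:
  "h_curvature (dual D) \<alpha> \<mu> \<sigma> \<nu> p =
    hcov D (h_torsion D) \<alpha> \<sigma> \<nu> \<mu> p
    + (\<Sum>\<epsilon>\<in>UNIV. vcoeff D \<alpha> \<epsilon> \<mu> p * nl_curvature (nl D) \<epsilon> \<sigma> \<nu> p)
    + L_tensor D \<alpha> \<sigma> \<nu> \<mu> p + L_tensor D \<alpha> \<nu> \<mu> \<sigma> p"
  using delta_hcoeff_swap[where \<alpha> = \<alpha> and \<nu> = \<sigma> and \<mu> = \<mu> and \<sigma> = \<nu>]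
    delta_hcoeff_swap[where \<alpha> = \<alpha> and \<nu> = \<nu> and \<mu> = \<sigma> and \<sigma> = \<mu>]
  by (simp add: h_curvature_def hcov_def L_tensor_def delta_h_torsion nl_curvature_antisym[of "nl D" _ \<nu> \<mu>]
      nl_curvature_antisym[of "nl D" _ \<mu> \<sigma>]
      sum_negf h_torsion_def algebra_simps sum.distrib sum_subtractf)

lemma v_curvature_dual: "v_curvature (dual D) \<alpha> \<mu> \<sigma> \<nu> p = vcov D (v_torsion D) \<alpha> \<sigma> \<nu> \<mu> p"
  using dy_vcoeff_swap[where \<alpha> = \<alpha> and \<nu> = \<sigma> and \<mu> = \<mu> and \<sigma> = \<nu>]
    dy_vcoeff_swap[where \<alpha> = \<alpha> and \<nu> = \<nu> and \<mu> = \<sigma> and \<sigma> = \<mu>]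
  by (simp add: v_curvature_def vcov_def dy_v_torsion v_torsion_def algebra_simps sum.distrib sum_subtractf)

text \<open>The derivatives on the two sides differ by \<open>dy \<mu> (hcoeff D \<alpha> \<nu>
  \<sigma>) p - delta (nl D) \<sigma> (vcoeff D \<alpha> \<nu> \<mu>) p\<close>, so a single use of
  \<open>dy_hcoeff\<close> suffices.\<close>

lemma hv_curvature_dual:
  "hv_curvature (dual D) \<alpha> \<nu> \<mu> \<sigma> p =
    hcov D (v_torsion D) \<alpha> \<mu> \<nu> \<sigma> p - vcov D (h_torsion D) \<alpha> \<sigma> \<nu> \<mu> p
    + (\<Sum>\<epsilon>\<in>UNIV. v_torsion D \<epsilon> \<mu> \<nu> p * h_torsion D \<alpha> \<sigma> \<epsilon> p)
    - (\<Sum>\<epsilon>\<in>UNIV. v_torsion D \<alpha> \<mu> \<epsilon> p * h_torsion D \<epsilon> \<sigma> \<nu> p)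
    - (\<Sum>\<epsilon>\<in>UNIV. h_torsion D \<alpha> \<epsilon> \<nu> p * vcoeff D \<epsilon> \<sigma> \<mu> p)
    - (\<Sum>\<epsilon>\<in>UNIV. hv_torsion D \<epsilon> \<sigma> \<mu> p * v_torsion D \<alpha> \<epsilon> \<nu> p)"
  using dy_hcoeff[where \<mu> = \<mu> and \<alpha> = \<alpha> and \<nu> = \<nu> and \<sigma> = \<sigma>]
  by (simp add: hv_curvature_def hcov_def vcov_def delta_v_torsion dy_h_torsion
      h_torsion_def v_torsion_def hv_torsion_def algebra_simps sum.distrib sum_subtractf)

text \<open>The half-sums on the left and the half-differences on the right differ by one
  antisymmetrized derivative of \<open>hcoeff\<close>, removed by one exchange. Its curvature term
  turns the symmetrized \<open>vcoeff\<close> into half of \<open>v_torsion\<close>.\<close>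

lemma h_curvature_symmetric:
  "h_curvature (symmetric D) \<alpha> \<mu> \<sigma> \<nu> p =
    1/2 * (hcov D (h_torsion D) \<alpha> \<mu> \<nu> \<sigma> p - hcov D (h_torsion D) \<alpha> \<mu> \<sigma> \<nu> p)
    + 1/4 * ((\<Sum>\<epsilon>\<in>UNIV. h_torsion D \<epsilon> \<mu> \<nu> p * h_torsion D \<alpha> \<sigma> \<epsilon> p)
      - (\<Sum>\<epsilon>\<in>UNIV. h_torsion D \<epsilon> \<mu> \<sigma> p * h_torsion D \<alpha> \<nu> \<epsilon> p))
    + 1/2 * (\<Sum>\<epsilon>\<in>UNIV. h_torsion D \<epsilon> \<sigma> \<nu> p * h_torsion D \<alpha> \<epsilon> \<mu> p)
    + 1/2 * (\<Sum>\<epsilon>\<in>UNIV. v_torsion D \<alpha> \<epsilon> \<mu> p * nl_curvature (nl D) \<epsilon> \<sigma> \<nu> p)"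
  unfolding h_curvature_def symmetric_simps sum_half_sums_mult sum_half_sum_mult
    delta_half_sum[OF hcoeff_differentiable hcoeff_differentiable]
  using delta_hcoeff_swap[where \<alpha> = \<alpha> and \<nu> = \<mu> and \<mu> = \<sigma> and \<sigma> = \<nu>]
  by (simp add: hcov_def delta_h_torsion h_torsion_def v_torsion_def algebra_simps sum.distrib sum_subtractf)

lemma v_curvature_symmetric:
  "v_curvature (symmetric D) \<alpha> \<mu> \<sigma> \<nu> p =
    1/2 * (vcov D (v_torsion D) \<alpha> \<mu> \<nu> \<sigma> p - vcov D (v_torsion D) \<alpha> \<mu> \<sigma> \<nu> p)
    + 1/4 * ((\<Sum>\<epsilon>\<in>UNIV. v_torsion D \<epsilon> \<mu> \<nu> p * v_torsion D \<alpha> \<sigma> \<epsilon> p)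
      - (\<Sum>\<epsilon>\<in>UNIV. v_torsion D \<epsilon> \<mu> \<sigma> p * v_torsion D \<alpha> \<nu> \<epsilon> p))
    + 1/2 * (\<Sum>\<epsilon>\<in>UNIV. v_torsion D \<epsilon> \<sigma> \<nu> p * v_torsion D \<alpha> \<epsilon> \<mu> p)"
  unfolding v_curvature_def symmetric_simps sum_half_sums_mult
    dy_half_sum[OF vcoeff_differentiable vcoeff_differentiable]
  using dy_vcoeff_swap[where \<alpha> = \<alpha> and \<nu> = \<mu> and \<mu> = \<sigma> and \<sigma> = \<nu>]
  by (simp add: vcov_def dy_v_torsion v_torsion_def algebra_simps sum.distrib sum_subtractf)

text \<open>Again one use of \<open>dy_hcoeff\<close> removes all derivatives. In the cyclic sum
  every product has one factor of each kind, with the horizontal index \<sigma> always in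
  \<open>h_torsion\<close>.\<close>

lemma hv_curvature_symmetric:
  "hv_curvature (symmetric D) \<alpha> \<nu> \<mu> \<sigma> p =
    1/2 * (hcov D (v_torsion D) \<alpha> \<mu> \<nu> \<sigma> p - vcov D (h_torsion D) \<alpha> \<sigma> \<nu> \<mu> p)
    + 1/4 * (\<Sum>\<epsilon>\<in>UNIV. h_torsion D \<epsilon> \<sigma> \<mu> p * v_torsion D \<alpha> \<epsilon> \<nu> p)
    - 1/2 * (\<Sum>\<epsilon>\<in>UNIV. h_torsion D \<alpha> \<epsilon> \<nu> p * vcoeff D \<epsilon> \<sigma> \<mu> p)
    + 1/4 * ((\<Sum>\<epsilon>\<in>UNIV. v_torsion D \<epsilon> \<mu> \<nu> p * h_torsion D \<alpha> \<sigma> \<epsilon> p)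
      + (\<Sum>\<epsilon>\<in>UNIV. h_torsion D \<epsilon> \<nu> \<sigma> p * v_torsion D \<alpha> \<mu> \<epsilon> p)
      + (\<Sum>\<epsilon>\<in>UNIV. h_torsion D \<epsilon> \<sigma> \<mu> p * v_torsion D \<alpha> \<nu> \<epsilon> p))
    - 1/2 * (\<Sum>\<epsilon>\<in>UNIV. hv_torsion D \<epsilon> \<sigma> \<mu> p * v_torsion D \<alpha> \<epsilon> \<nu> p)"
  unfolding hv_curvature_def hcov_def symmetric_simps left_diff_distrib sum_subtractf
    sum_half_sums_mult mult.commute[of "dy _ _ _"] sum_half_sum_mult
    dy_half_sum[OF hcoeff_differentiable hcoeff_differentiable]
    delta_half_sum[OF vcoeff_differentiable vcoeff_differentiable]
  using dy_hcoeff[where \<mu> = \<mu> and \<alpha> = \<alpha> and \<nu> = \<nu> and \<sigma> = \<sigma>]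
  by (simp add: vcov_def delta_v_torsion dy_h_torsion
      h_torsion_def v_torsion_def hv_torsion_def algebra_simps sum.distrib sum_subtractf)

section \<open>A d-connection with the same \<open>N\<close> in terms of contortion\<close>

context
  fixes Dr :: "'n d_connection"
  assumes nl_eq: "nl Dr = nl D"
    and hcoeff_differentiable': "\<And>\<alpha> \<mu> \<nu>. hcoeff Dr \<alpha> \<mu> \<nu> differentiable (at p)"
    and vcoeff_differentiable': "\<And>\<alpha> \<mu> \<nu>. vcoeff Dr \<alpha> \<mu> \<nu> differentiable (at p)"
begin

lemma delta_h_contortion:
  "delta N \<kappa> (h_contortion D Dr \<alpha> \<mu> \<nu>) p = delta N \<kappa> (hcoeff D \<alpha> \<mu> \<nu>) p - delta N \<kappa> (hcoeff Dr \<alpha> \<mu> \<nu>) p"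
  by (simp add: h_contortion_def[abs_def] delta_diff hcoeff_differentiable hcoeff_differentiable')

lemma delta_v_contortion:
  "delta N \<kappa> (v_contortion D Dr \<alpha> \<mu> \<nu>) p = delta N \<kappa> (vcoeff D \<alpha> \<mu> \<nu>) p - delta N \<kappa> (vcoeff Dr \<alpha> \<mu> \<nu>) p"
  by (simp add: v_contortion_def[abs_def] delta_diff vcoeff_differentiable vcoeff_differentiable')

lemma dy_h_contortion:
  "dy \<kappa> (h_contortion D Dr \<alpha> \<mu> \<nu>) p = dy \<kappa> (hcoeff D \<alpha> \<mu> \<nu>) p - dy \<kappa> (hcoeff Dr \<alpha> \<mu> \<nu>) p"
  by (simp add: h_contortion_def[abs_def] dy_diff hcoeff_differentiable hcoeff_differentiable')

lemma dy_v_contortion: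
  "dy \<kappa> (v_contortion D Dr \<alpha> \<mu> \<nu>) p = dy \<kappa> (vcoeff D \<alpha> \<mu> \<nu>) p - dy \<kappa> (vcoeff Dr \<alpha> \<mu> \<nu>) p"
  by (simp add: v_contortion_def[abs_def] dy_diff vcoeff_differentiable vcoeff_differentiable')

text \<open>Writing the coefficients of \<open>Dr\<close> as those of \<open>D\<close> minus the
  contortion, the derivatives of \<open>hcoeff D\<close> drop out by flatness. The term with
  \<open>h_torsion\<close> compensates the corrections that \<open>hcov\<close> makes for the last
  lower index of the contortion.\<close>

lemma h_curvature_contortion:
  "h_curvature Dr \<alpha> \<mu> \<sigma> \<nu> p =
    hcov D (h_contortion D Dr) \<alpha> \<mu> \<nu> \<sigma> p - hcov D (h_contortion D Dr) \<alpha> \<mu> \<sigma> \<nu> p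
    + (\<Sum>\<epsilon>\<in>UNIV. h_contortion D Dr \<epsilon> \<mu> \<sigma> p * h_contortion D Dr \<alpha> \<epsilon> \<nu> p)
    - (\<Sum>\<epsilon>\<in>UNIV. h_contortion D Dr \<epsilon> \<mu> \<nu> p * h_contortion D Dr \<alpha> \<epsilon> \<sigma> p)
    + (\<Sum>\<epsilon>\<in>UNIV. h_contortion D Dr \<alpha> \<mu> \<epsilon> p * h_torsion D \<epsilon> \<nu> \<sigma> p)
    + (\<Sum>\<epsilon>\<in>UNIV. v_contortion D Dr \<alpha> \<mu> \<epsilon> p * nl_curvature (nl D) \<epsilon> \<nu> \<sigma> p)"
  using delta_hcoeff_swap[where \<alpha> = \<alpha> and \<nu> = \<mu> and \<mu> = \<sigma> and \<sigma> = \<nu>]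
  by (simp add: h_curvature_def nl_eq hcov_def delta_h_contortion nl_curvature_antisym[of "nl D" _ \<nu> \<sigma>]
      h_contortion_def v_contortion_def h_torsion_def sum_negf algebra_simps sum.distrib sum_subtractf)

lemma v_curvature_contortion:
  "v_curvature Dr \<alpha> \<mu> \<sigma> \<nu> p =
    vcov D (v_contortion D Dr) \<alpha> \<mu> \<nu> \<sigma> p - vcov D (v_contortion D Dr) \<alpha> \<mu> \<sigma> \<nu> p
    + (\<Sum>\<epsilon>\<in>UNIV. v_contortion D Dr \<epsilon> \<mu> \<sigma> p * v_contortion D Dr \<alpha> \<epsilon> \<nu> p)
    - (\<Sum>\<epsilon>\<in>UNIV. v_contortion D Dr \<epsilon> \<mu> \<nu> p * v_contortion D Dr \<alpha> \<epsilon> \<sigma> p)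
    + (\<Sum>\<epsilon>\<in>UNIV. v_contortion D Dr \<alpha> \<mu> \<epsilon> p * v_torsion D \<epsilon> \<nu> \<sigma> p)"
  using dy_vcoeff_swap[where \<alpha> = \<alpha> and \<nu> = \<mu> and \<mu> = \<sigma> and \<sigma> = \<nu>]
  by (simp add: v_curvature_def vcov_def dy_v_contortion v_contortion_def v_torsion_def
      algebra_simps sum.distrib sum_subtractf)

text \<open>The same substitution applies; each factor \<open>v_contortion - vcoeff\<close> is minus
  a vertical coefficient of \<open>Dr\<close>.\<close>

lemma hv_curvature_contortion:
  "hv_curvature Dr \<alpha> \<nu> \<mu> \<sigma> p =
    dy \<mu> (h_contortion D Dr \<alpha> \<nu> \<sigma>) p - hcov D (v_contortion D Dr) \<alpha> \<nu> \<mu> \<sigma> p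
    + (\<Sum>\<epsilon>\<in>UNIV. (v_contortion D Dr \<epsilon> \<nu> \<mu> p - vcoeff D \<epsilon> \<nu> \<mu> p) * h_contortion D Dr \<alpha> \<epsilon> \<sigma> p)
    - (\<Sum>\<epsilon>\<in>UNIV. (v_contortion D Dr \<alpha> \<epsilon> \<mu> p - vcoeff D \<alpha> \<epsilon> \<mu> p) * h_contortion D Dr \<epsilon> \<nu> \<sigma> p)
    + (\<Sum>\<epsilon>\<in>UNIV. hv_torsion D \<epsilon> \<sigma> \<mu> p * v_contortion D Dr \<alpha> \<nu> \<epsilon> p)"
  using dy_hcoeff[where \<mu> = \<mu> and \<alpha> = \<alpha> and \<nu> = \<nu> and \<sigma> = \<sigma>]
  by (simp add: hv_curvature_def nl_eq hcov_def delta_v_contortion dy_h_contortion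
      h_contortion_def v_contortion_def hv_torsion_def algebra_simps sum.distrib sum_subtractf)

end

end

section \<open>The frame of a GAP-space in an induced chart\<close>

context
  fixes X :: "'a topology" and A :: "('a, 'n::finite) chart set"
  assumes M: "smooth_manifold X A"
begin

lemma chart_inj: "c \<in> A \<Longrightarrow> inj_on (snd c) (fst c)"
proof -
  assume c: "c \<in> A"
  have "fst c \<subseteq> topspace X" using M c unfolding smooth_manifold_def by auto
  moreover have "homeomorphic_map (subtopology X (fst c)) (top_of_set (snd c ` fst c)) (snd c)"
    using M c unfolding smooth_manifold_def by blast
  ultimately show ?thesis
    using homeomorphic_imp_injective_map by (metis inf.absorb_iff2 topspace_subtopology)
qed

lemma open_chart_image_Int:
  assumes "c \<in> A" and "c' \<in> A"
  shows "open (snd c ` (fst c \<inter> fst c'))"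
proof -
  have "openin (subtopology X (fst c)) (fst c \<inter> fst c')"
    using M assms unfolding smooth_manifold_def by (simp add: openin_subtopology_Int2)
  moreover have "open_map (subtopology X (fst c)) (top_of_set (snd c ` fst c)) (snd c)"
    using M assms(1) unfolding smooth_manifold_def by (blast intro: homeomorphic_imp_open_map)
  ultimately have "openin (top_of_set (snd c ` fst c)) (snd c ` (fst c \<inter> fst c'))"
    by (simp add: open_map_def)
  moreover have "open (snd c ` fst c)"
    using M assms(1) unfolding smooth_manifold_def by blast
  ultimately show ?thesis
    using openin_open_trans by blast
qed

lemma open_induced_image: "c \<in> A \<Longrightarrow> open (induced_image c)"
  using open_chart_image_Int[of c c] by (simp add: induced_image_def open_Times)

lemma transition_chart: "c \<in> A \<Longrightarrow> m \<in> fst c \<Longrightarrow> transition c c' (snd c m) = snd c' m"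
  by (simp add: transition_def chart_inj)

lemma has_derivative_transition:
  assumes "c \<in> A" and "c' \<in> A" and "m \<in> fst c" and "m \<in> fst c'"
  shows "(transition c c' has_derivative frechet_derivative (transition c c') (at (snd c m))) (at (snd c m))"
proof -
  have "smooth_on (snd c ` (fst c \<inter> fst c')) (transition c c')"
    using M assms unfolding smooth_manifold_def by blast
  then have "Ck_on (Suc 0) (snd c ` (fst c \<inter> fst c')) (transition c c')"
    unfolding smooth_on_def by blast
  then show ?thesis
    by (rule Ck_on_Suc_has_derivative) (use assms in blast)
qed

text \<open>Rewrites the transformation law of tangent vectors as a linear map, so that the chain
  rule can replace calculations with Jacobian entries.\<close>

lemma sum_jac:
  assumes "c \<in> A" and "c' \<in> A" and "m \<in> fst c" and "m \<in> fst c'"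
  shows "(\<Sum>\<alpha>\<in>UNIV. jac c c' \<alpha>' \<alpha> (snd c m) * w $ \<alpha>) =
    frechet_derivative (transition c c') (at (snd c m)) w $ \<alpha>'"
proof -
  let ?T = "frechet_derivative (transition c c') (at (snd c m))"
  note T = has_derivative_transition[OF assms]
  interpret linear ?T using T by (rule has_derivative_linear)
  have "((\<lambda>z. transition c c' z $ \<alpha>') has_derivative (\<lambda>h. ?T h $ \<alpha>')) (at (snd c m))"
    using T by (rule bounded_linear.has_derivative[OF bounded_linear_vec_nth])
  then have "jac c c' \<alpha>' \<alpha> (snd c m) = ?T (axis \<alpha> 1) $ \<alpha>'" for \<alpha>
    unfolding jac_def by (simp flip: frechet_derivative_at)
  moreover have "?T w = ?T (\<Sum>\<alpha>\<in>UNIV. w $ \<alpha> *\<^sub>R axis \<alpha> 1)"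
    using basis_expansion[of w] by (simp add: scalar_mult_eq_scaleR)
  ultimately show ?thesis
    by (simp only: sum scale) (simp add: mult.commute)
qed

text \<open>The composite of the two transitions agrees with the direct one on the overlap of
  \<open>c\<close> and \<open>c'\<close>, whose coordinate image is open.\<close>

lemma transition_chain_rule:
  assumes "c \<in> A" and "c' \<in> A" and "c'' \<in> A" and "m \<in> fst c" and "m \<in> fst c'" and "m \<in> fst c''"
  shows "frechet_derivative (transition c c'') (at (snd c m)) w =
    frechet_derivative (transition c' c'') (at (snd c' m)) (frechet_derivative (transition c c') (at (snd c m)) w)"
proof -
  have "((\<lambda>x. transition c' c'' (transition c c' x)) has_derivative
      (\<lambda>w. frechet_derivative (transition c' c'') (at (snd c' m)) (frechet_derivative (transition c c') (at (snd c m)) w)))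
      (at (snd c m))"
    using assms by (intro has_derivative_compose[OF has_derivative_transition])
      (simp_all add: transition_chart has_derivative_transition)
  then have "(transition c c'' has_derivative
      (\<lambda>w. frechet_derivative (transition c' c'') (at (snd c' m)) (frechet_derivative (transition c c') (at (snd c m)) w)))
      (at (snd c m))"
    by (rule has_derivative_transform_within_open[OF _ open_chart_image_Int[OF assms(1,2)]])
      (use assms in \<open>auto simp: transition_chart\<close>)
  from frechet_derivative_at[OF this] show ?thesis by metis
qed

lemma transition_self_derivative:
  assumes "c \<in> A" and "m \<in> fst c"
  shows "frechet_derivative (transition c c) (at (snd c m)) w = w"
proof -
  have "(transition c c has_derivative (\<lambda>w. w)) (at (snd c m))"
    by (rule has_derivative_transform_within_open[OF has_derivative_ident open_chart_image_Int[OF assms(1,1)]])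
      (use assms in \<open>auto simp: transition_chart\<close>)
  from frechet_derivative_at[OF this] show ?thesis by metis
qed

text \<open>Ensures that \<open>inv_into\<close> in \<open>section_component\<close> returns an
  actual tangent vector at every point of \<open>induced_image c\<close>.\<close>

lemma induced_chart_surj:
  assumes c: "c \<in> A" and "p \<in> induced_image c"
  shows "p \<in> induced_chart c ` induced_dom X A c"
proof -
  obtain m y where p: "p = (snd c m, y)" and m: "m \<in> fst c"
    using assms(2) unfolding induced_image_def by auto
  \<comment> \<open>The components \<open>y\<close> in \<open>c\<close> are pushed to the other
    charts around \<open>m\<close>; the chain rule gives the transformation law. The value 0
    elsewhere is the one \<open>tangent_space\<close> prescribes.\<close>
  define v where "v c' = (if c' \<in> A \<and> m \<in> fst c' then frechet_derivative (transition c c') (at (snd c m)) y else 0)" for c'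
  have "v c'' $ \<alpha>' = (\<Sum>\<alpha>\<in>UNIV. jac c' c'' \<alpha>' \<alpha> (snd c' m) * v c' $ \<alpha>)"
    if "c' \<in> A" "c'' \<in> A" "m \<in> fst c'" "m \<in> fst c''" for c' c'' \<alpha>'
    using that c m by (simp add: v_def sum_jac transition_chain_rule[of c c' c''])
  moreover have "v c' = 0" if "\<not> (c' \<in> A \<and> m \<in> fst c')" for c'
    using that by (auto simp: v_def)
  ultimately have "v \<in> tangent_space A m"
    unfolding tangent_space_def by blast
  moreover have "m \<in> topspace X"
    using M c m unfolding smooth_manifold_def by blast
  moreover have "v c = y"
    using c m by (simp add: v_def transition_self_derivative)
  ultimately have "(m, v) \<in> induced_dom X A c" "induced_chart c (m, v) = p"
    using m p by (auto simp: induced_dom_def tangent_bundle_def induced_chart_def)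
  then show ?thesis by (metis image_eqI)
qed

end

text \<open>Independence of the sections concerns their components in all charts. A linear relation
  among the components in \<open>c\<close> spreads to every other chart by the transformation law,
  so the matrix in \<open>c\<close> has trivial kernel.\<close>

lemma gap_space_frame_invertible:
  assumes gap: "gap_space X A lam" and c: "c \<in> A" and p: "p \<in> induced_image c"
  shows "invertible (\<chi> \<alpha> j. section_component X A c (lam j) \<alpha> p)"
proof -
  define q where "q = inv_into (induced_dom X A c) (induced_chart c) p"
  have "smooth_manifold X A" using gap by (simp add: gap_space_def)
  then have "q \<in> induced_dom X A c"
    unfolding q_def by (intro inv_into_into induced_chart_surj c p)
  then have q: "q \<in> tangent_bundle X A" "fst q \<in> fst c" by (auto simp: induced_dom_def)
  have lam: "lam i q \<in> tangent_space A (fst q)" for i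
    using gap q(1) by (simp add: gap_space_def pullback_section_def)
  have "a = 0" if "(\<chi> \<alpha> j. section_component X A c (lam j) \<alpha> p) *v a = 0" for a
  proof -
    have in_c: "(\<Sum>i\<in>UNIV. a $ i * lam i q c $ \<alpha>) = 0" for \<alpha>
      using that by (simp add: vec_eq_iff matrix_vector_mult_def section_component_def q_def mult.commute)
    have "(\<Sum>i\<in>UNIV. a $ i *\<^sub>R lam i q c') = 0" for c'
    proof (cases "c' \<in> A \<and> fst q \<in> fst c'")
      case True
      then have tr: "lam i q c' $ \<alpha>' = (\<Sum>\<alpha>\<in>UNIV. jac c c' \<alpha>' \<alpha> (snd c (fst q)) * lam i q c $ \<alpha>)" for i \<alpha>'
        using lam[of i] c q(2) unfolding tangent_space_def by blast
      have "(\<Sum>i\<in>UNIV. a $ i * lam i q c' $ \<alpha>') =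
          (\<Sum>\<alpha>\<in>UNIV. jac c c' \<alpha>' \<alpha> (snd c (fst q)) * (\<Sum>i\<in>UNIV. a $ i * lam i q c $ \<alpha>))" for \<alpha>'
        unfolding tr sum_distrib_left by (subst sum.swap) (simp add: mult.left_commute)
      then show ?thesis by (simp add: vec_eq_iff in_c)
    next
      case False
      then have "lam i q c' = 0" for i
        using lam[of i] unfolding tangent_space_def by blast
      then show ?thesis by simp
    qed
    then have "\<forall>i. a $ i = 0"
      using gap q(1) unfolding gap_space_def by blast
    then show "a = 0" by (simp add: vec_eq_iff)
  qed
  then show ?thesis
    unfolding invertible_left_inverse matrix_left_invertible_ker by blast
qed

lemma gap_space_smooth_frame:
  assumes gap: "gap_space X A lam" and N: "nonlinear_connection X A N" and c: "c \<in> A"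
  shows "smooth_frame (N c) (\<lambda>i. section_component X A c (lam i)) (induced_image c)"
proof
  have "smooth_manifold X A" using gap by (simp add: gap_space_def)
  then show "open (induced_image c)" using c by (rule open_induced_image)
  show "Ck_on 1 (induced_image c) (N c \<alpha> \<mu>)" for \<alpha> \<mu>
    using N c by (simp only: nonlinear_connection_def smooth_on_def)
  show "Ck_on 2 (induced_image c) (section_component X A c (lam i) \<alpha>)" for i \<alpha>
    using gap c by (simp only: gap_space_def pullback_section_def smooth_on_def)
  show "invertible (\<chi> \<alpha> j. section_component X A c (lam j) \<alpha> q)" if "q \<in> induced_image c" for q
    using gap c that by (rule gap_space_frame_invertible)
qed

theorem theorem4p6:
  fixes X :: "'a topology"
    and A :: "('a, 'n::finite) chart set"
    and lam :: "'n \<Rightarrow> 'a \<times> ('a, 'n) tvec \<Rightarrow> ('a, 'n) tvec"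
    and N :: "('a, 'n) chart \<Rightarrow> 'n \<Rightarrow> 'n \<Rightarrow> 'n pt \<Rightarrow> real"
    and c :: "('a, 'n) chart"
    and p :: "'n pt"
    and D Dr :: "'n d_connection"
    and C \<Lambda> T \<gamma> G R P :: "'n \<Rightarrow> 'n \<Rightarrow> 'n \<Rightarrow> 'n pt \<Rightarrow> real"
    and L :: "'n \<Rightarrow> 'n \<Rightarrow> 'n \<Rightarrow> 'n \<Rightarrow> 'n pt \<Rightarrow> real"
    and \<alpha> \<mu> \<nu> \<sigma> :: 'n
  assumes "gap_space X A lam"
    and "nonlinear_connection X A N"
    and "c \<in> A"
    and "p \<in> induced_image c"
    and "D = canonical (N c) (\<lambda>i. section_component X A c (lam i))"
    and "Dr = riemannian (N c) (\<lambda>i. section_component X A c (lam i))"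
    and "C = vcoeff D"
    and "\<Lambda> = h_torsion D"
    and "T = v_torsion D"
    and "\<gamma> = h_contortion D Dr"
    and "G = v_contortion D Dr"
    and "R = nl_curvature (N c)"
    and "P = hv_torsion D"
    and "L = L_tensor D"
  shows
    "h_curvature (dual D) \<alpha> \<mu> \<sigma> \<nu> p =
       hcov D \<Lambda> \<alpha> \<sigma> \<nu> \<mu> p + (\<Sum>\<epsilon>\<in>UNIV. C \<alpha> \<epsilon> \<mu> p * R \<epsilon> \<sigma> \<nu> p) + L \<alpha> \<sigma> \<nu> \<mu> p + L \<alpha> \<nu> \<mu> \<sigma> p
     \<and>
     v_curvature (dual D) \<alpha> \<mu> \<sigma> \<nu> p = vcov D T \<alpha> \<sigma> \<nu> \<mu> p
     \<and>
     hv_curvature (dual D) \<alpha> \<nu> \<mu> \<sigma> p =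
       hcov D T \<alpha> \<mu> \<nu> \<sigma> p - vcov D \<Lambda> \<alpha> \<sigma> \<nu> \<mu> p
       + (\<Sum>\<epsilon>\<in>UNIV. T \<epsilon> \<mu> \<nu> p * \<Lambda> \<alpha> \<sigma> \<epsilon> p) - (\<Sum>\<epsilon>\<in>UNIV. T \<alpha> \<mu> \<epsilon> p * \<Lambda> \<epsilon> \<sigma> \<nu> p)
       - (\<Sum>\<epsilon>\<in>UNIV. \<Lambda> \<alpha> \<epsilon> \<nu> p * C \<epsilon> \<sigma> \<mu> p) - (\<Sum>\<epsilon>\<in>UNIV. P \<epsilon> \<sigma> \<mu> p * T \<alpha> \<epsilon> \<nu> p)
     \<and>
     h_curvature (symmetric D) \<alpha> \<mu> \<sigma> \<nu> p =
       1/2 * (hcov D \<Lambda> \<alpha> \<mu> \<nu> \<sigma> p - hcov D \<Lambda> \<alpha> \<mu> \<sigma> \<nu> p)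
       + 1/4 * ((\<Sum>\<epsilon>\<in>UNIV. \<Lambda> \<epsilon> \<mu> \<nu> p * \<Lambda> \<alpha> \<sigma> \<epsilon> p) - (\<Sum>\<epsilon>\<in>UNIV. \<Lambda> \<epsilon> \<mu> \<sigma> p * \<Lambda> \<alpha> \<nu> \<epsilon> p))
       + 1/2 * (\<Sum>\<epsilon>\<in>UNIV. \<Lambda> \<epsilon> \<sigma> \<nu> p * \<Lambda> \<alpha> \<epsilon> \<mu> p)
       + 1/2 * (\<Sum>\<epsilon>\<in>UNIV. T \<alpha> \<epsilon> \<mu> p * R \<epsilon> \<sigma> \<nu> p)
     \<and>
     v_curvature (symmetric D) \<alpha> \<mu> \<sigma> \<nu> p =
       1/2 * (vcov D T \<alpha> \<mu> \<nu> \<sigma> p - vcov D T \<alpha> \<mu> \<sigma> \<nu> p)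
       + 1/4 * ((\<Sum>\<epsilon>\<in>UNIV. T \<epsilon> \<mu> \<nu> p * T \<alpha> \<sigma> \<epsilon> p) - (\<Sum>\<epsilon>\<in>UNIV. T \<epsilon> \<mu> \<sigma> p * T \<alpha> \<nu> \<epsilon> p))
       + 1/2 * (\<Sum>\<epsilon>\<in>UNIV. T \<epsilon> \<sigma> \<nu> p * T \<alpha> \<epsilon> \<mu> p)
     \<and>
     hv_curvature (symmetric D) \<alpha> \<nu> \<mu> \<sigma> p =
       1/2 * (hcov D T \<alpha> \<mu> \<nu> \<sigma> p - vcov D \<Lambda> \<alpha> \<sigma> \<nu> \<mu> p)
       + 1/4 * (\<Sum>\<epsilon>\<in>UNIV. \<Lambda> \<epsilon> \<sigma> \<mu> p * T \<alpha> \<epsilon> \<nu> p)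
       - 1/2 * (\<Sum>\<epsilon>\<in>UNIV. \<Lambda> \<alpha> \<epsilon> \<nu> p * C \<epsilon> \<sigma> \<mu> p)
       + 1/4 * ((\<Sum>\<epsilon>\<in>UNIV. T \<epsilon> \<mu> \<nu> p * \<Lambda> \<alpha> \<sigma> \<epsilon> p)
              + (\<Sum>\<epsilon>\<in>UNIV. \<Lambda> \<epsilon> \<nu> \<sigma> p * T \<alpha> \<mu> \<epsilon> p)
              + (\<Sum>\<epsilon>\<in>UNIV. \<Lambda> \<epsilon> \<sigma> \<mu> p * T \<alpha> \<nu> \<epsilon> p))
       - 1/2 * (\<Sum>\<epsilon>\<in>UNIV. P \<epsilon> \<sigma> \<mu> p * T \<alpha> \<epsilon> \<nu> p)
     \<and>
     h_curvature Dr \<alpha> \<mu> \<sigma> \<nu> p =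
       hcov D \<gamma> \<alpha> \<mu> \<nu> \<sigma> p - hcov D \<gamma> \<alpha> \<mu> \<sigma> \<nu> p
       + (\<Sum>\<epsilon>\<in>UNIV. \<gamma> \<epsilon> \<mu> \<sigma> p * \<gamma> \<alpha> \<epsilon> \<nu> p) - (\<Sum>\<epsilon>\<in>UNIV. \<gamma> \<epsilon> \<mu> \<nu> p * \<gamma> \<alpha> \<epsilon> \<sigma> p)
       + (\<Sum>\<epsilon>\<in>UNIV. \<gamma> \<alpha> \<mu> \<epsilon> p * \<Lambda> \<epsilon> \<nu> \<sigma> p) + (\<Sum>\<epsilon>\<in>UNIV. G \<alpha> \<mu> \<epsilon> p * R \<epsilon> \<nu> \<sigma> p)
     \<and>
     v_curvature Dr \<alpha> \<mu> \<sigma> \<nu> p =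
       vcov D G \<alpha> \<mu> \<nu> \<sigma> p - vcov D G \<alpha> \<mu> \<sigma> \<nu> p
       + (\<Sum>\<epsilon>\<in>UNIV. G \<epsilon> \<mu> \<sigma> p * G \<alpha> \<epsilon> \<nu> p) - (\<Sum>\<epsilon>\<in>UNIV. G \<epsilon> \<mu> \<nu> p * G \<alpha> \<epsilon> \<sigma> p)
       + (\<Sum>\<epsilon>\<in>UNIV. G \<alpha> \<mu> \<epsilon> p * T \<epsilon> \<nu> \<sigma> p)
     \<and>
     hv_curvature Dr \<alpha> \<nu> \<mu> \<sigma> p =
       dy \<mu> (\<gamma> \<alpha> \<nu> \<sigma>) p - hcov D G \<alpha> \<nu> \<mu> \<sigma> p
       + (\<Sum>\<epsilon>\<in>UNIV. (G \<epsilon> \<nu> \<mu> p - C \<epsilon> \<nu> \<mu> p) * \<gamma> \<alpha> \<epsilon> \<sigma> p)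
       - (\<Sum>\<epsilon>\<in>UNIV. (G \<alpha> \<epsilon> \<mu> p - C \<alpha> \<epsilon> \<mu> p) * \<gamma> \<epsilon> \<nu> \<sigma> p)
       + (\<Sum>\<epsilon>\<in>UNIV. P \<epsilon> \<sigma> \<mu> p * G \<alpha> \<nu> \<epsilon> p)"
proof -
  interpret frame: smooth_frame "N c" "\<lambda>i. section_component X A c (lam i)" "induced_image c"
    using assms(1-3) by (rule gap_space_smooth_frame)
  interpret flat_d_connection D p
    unfolding assms(5) using assms(4) by (rule frame.flat_d_connection_canonical)
  have nl: "nl D = N c" "nl Dr = nl D"
    by (simp_all add: assms(5,6) canonical_def riemannian_def)
  have Dr: "hcoeff Dr \<alpha> \<mu> \<nu> differentiable (at p)" "vcoeff Dr \<alpha> \<mu> \<nu> differentiable (at p)" for \<alpha> \<mu> \<nu>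
    unfolding assms(6) by (rule Ck_on_1_differentiable[OF _ assms(4)], rule frame.Ck_on_riemannian)+
  show ?thesis
    \<comment> \<open>Folding \<open>N c\<close> back to \<open>nl D\<close> makes each conjunct
      literally one of the nine formulas.\<close>
    unfolding assms(7-) nl(1)[symmetric]
    by (intro conjI h_curvature_dual v_curvature_dual hv_curvature_dual
        h_curvature_symmetric v_curvature_symmetric hv_curvature_symmetric
        h_curvature_contortion[OF nl(2) Dr] v_curvature_contortion[OF nl(2) Dr]
        hv_curvature_contortion[OF nl(2) Dr])
qed

end
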